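(* Let $N\ge 2$, let $D\subset\mathbb{R}^N$ be an open set, and let $\beta\in\mathcal{C}(D)$ be a continuous real-valued function. For every bounded domain $\Omega\subset\mathbb{R}^N$ of class $\mathcal{C}^{2,\alpha}$, for some $\alpha\in(0,1)$, with $\bar\Omega\subset D$, let $\sigma_1[-\Delta,\beta,\Omega]$ denote the principal eigenvalue of $$-\Delta u=\sigma u\ \text{ in }\Omega,\qquad \frac{\partial u}{\partial n}+\beta(x)u=0\ \text{ on }\partial\Omega.$$ Then $$\lim_{|\Omega|\downarrow 0}\sigma_1[-\Delta,\beta,\Omega]=+\infty\quad\text{if }\inf_D\beta>0,$$ and $$\lim_{|\Omega|\downarrow 0}\sigma_1[-\Delta,\beta,\Omega]=-\infty\quad\text{if }\sup_D\beta<0.$$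
   Context: Here $|\Omega|$ is the Lebesgue measure of $\Omega$ and $n$ is the outward unit normal vector field along $\partial\Omega$. The principal eigenvalue $\sigma_1[-\Delta,\beta,\Omega]$ is the unique real number $\sigma$ for which the boundary value problem admits a positive eigenfunction; it is known that it exists, that it is the smallest eigenvalue, and that the eigenfunction is unique up to a positive multiplicative constant, lies in $\mathcal{C}^1(\bar\Omega)\cap\mathcal{C}^2(\Omega)$ and is positive on $\bar\Omega$. The limit as $|\Omega|\downarrow0$ is taken over all admissible domains $\Omega$ (bounded domains of class $\mathcal{C}^{2,\alpha}$ with $\bar\Omega\subset D$), with $D$ and $\beta$ fixed: for instance, the limit being $+\infty$ means that for every $K>0$ there is $\delta>0$ such that $\sigma_1[-\Delta,\beta,\Omega]>K$ for every admissible $\Omega$ with $|\Omega|<\delta$. *)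

theory Defs
  imports "HOL-Analysis.Analysis"
begin

section \<open>Classes of differentiable functions\<close>

text \<open>The following notions are only used for open sets \<open>S\<close>.\<close>

definition partial_deriv :: "'n::finite \<Rightarrow> (real^'n \<Rightarrow> real) \<Rightarrow> real^'n \<Rightarrow> real" where
  "partial_deriv i f x = frechet_derivative f (at x) (axis i 1)"

definition grad :: "(real^'n::finite \<Rightarrow> real) \<Rightarrow> real^'n \<Rightarrow> real^'n" where
  "grad f x = (\<chi> i. partial_deriv i f x)"

definition laplacian :: "(real^'n::finite \<Rightarrow> real) \<Rightarrow> real^'n \<Rightarrow> real" where
  "laplacian f x = (\<Sum>i\<in>UNIV. partial_deriv i (partial_deriv i f) x)"

definition C1_on :: "(real^'n::finite) set \<Rightarrow> (real^'n \<Rightarrow> real) \<Rightarrow> bool" where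
  "C1_on S f \<longleftrightarrow> (\<forall>x\<in>S. f differentiable (at x)) \<and> (\<forall>i. continuous_on S (partial_deriv i f))"

definition C2_on :: "(real^'n::finite) set \<Rightarrow> (real^'n \<Rightarrow> real) \<Rightarrow> bool" where
  "C2_on S f \<longleftrightarrow> C1_on S f \<and> (\<forall>i. C1_on S (partial_deriv i f))"

definition C2_holder_on :: "real \<Rightarrow> (real^'n::finite) set \<Rightarrow> (real^'n \<Rightarrow> real) \<Rightarrow> bool" where
  "C2_holder_on \<alpha> S f \<longleftrightarrow> C2_on S f \<and>
     (\<exists>C. \<forall>i j. \<forall>x\<in>S. \<forall>y\<in>S.
        \<bar>partial_deriv i (partial_deriv j f) x - partial_deriv i (partial_deriv j f) y\<bar>
          \<le> C * dist x y powr \<alpha>)"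

section \<open>Domains of class C2,alpha and their outward unit normal\<close>

text \<open>
  Near each boundary point the domain is, after a rotation of the coordinates, the part of a
  ball lying strictly above the graph of a function of class C2,alpha.  The unit vector
  \<open>e\<close> is the vertical direction; a function of the remaining coordinates is represented by a
  function \<open>g\<close> on the whole space that is constant along \<open>e\<close>.  The ball, \<open>e\<close> and \<open>g\<close> depend on
  the boundary point \<open>z\<close>, the exponent \<open>\<alpha>\<close> does not.
\<close>

definition C2_holder_boundary :: "real \<Rightarrow> (real^'n::finite) set \<Rightarrow> bool" where
  "C2_holder_boundary \<alpha> \<Omega> \<longleftrightarrow>
     (\<forall>z\<in>frontier \<Omega>. \<exists>r>0. \<exists>e g.
        norm e = 1 \<and> (\<forall>x t. g (x + t *\<^sub>R e) = g x) \<and> C2_holder_on \<alpha> (ball z r) g \<and>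
        \<Omega> \<inter> ball z r = {x \<in> ball z r. g x < x \<bullet> e})"

definition admissible_domain :: "(real^'n::finite) set \<Rightarrow> (real^'n) set \<Rightarrow> bool" where
  "admissible_domain D \<Omega> \<longleftrightarrow>
     open \<Omega> \<and> connected \<Omega> \<and> \<Omega> \<noteq> {} \<and> bounded \<Omega> \<and>
     (\<exists>\<alpha>\<in>{0<..<1}. C2_holder_boundary \<alpha> \<Omega>) \<and> closure \<Omega> \<subseteq> D"

definition tangent_vectors :: "(real^'n::finite) set \<Rightarrow> real^'n \<Rightarrow> (real^'n) set" where
  "tangent_vectors M x =
     {v. \<exists>c. c 0 = x \<and> (\<forall>\<^sub>F t in nhds 0. c t \<in> M) \<and> (c has_vector_derivative v) (at 0)}"

definition outward_unit_normal :: "(real^'n::finite) set \<Rightarrow> real^'n \<Rightarrow> real^'n" where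
  "outward_unit_normal \<Omega> x =
     (THE \<nu>. norm \<nu> = 1 \<and> (\<forall>v\<in>tangent_vectors (frontier \<Omega>) x. \<nu> \<bullet> v = 0) \<and>
           (\<forall>\<^sub>F t in at_right 0. x + t *\<^sub>R \<nu> \<notin> closure \<Omega>))"

section \<open>The Robin eigenvalue problem\<close>

text \<open>
  Membership of \<open>u\<close> in C1 up to the boundary means that \<open>u\<close> and its gradient on \<open>\<Omega>\<close> have
  continuous extensions to the closure: the extension of \<open>u\<close> is \<open>u\<close> itself, that of the
  gradient is \<open>G\<close> (which is then unique on the closure).  The values of \<open>u\<close> outside the
  closure play no role, so \<open>grad u\<close> itself is only meaningful on \<open>\<Omega>\<close> and the normal
  derivative at a boundary point is formed with \<open>G\<close>.
\<close>

definition positive_eigenfunction ::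
  "(real^'n::finite \<Rightarrow> real) \<Rightarrow> (real^'n) set \<Rightarrow> real \<Rightarrow> (real^'n \<Rightarrow> real) \<Rightarrow> bool" where
  "positive_eigenfunction \<beta> \<Omega> \<sigma> u \<longleftrightarrow>
     C2_on \<Omega> u \<and> continuous_on (closure \<Omega>) u \<and>
     (\<forall>x\<in>\<Omega>. u x > 0) \<and>
     (\<forall>x\<in>\<Omega>. - laplacian u x = \<sigma> * u x) \<and>
     (\<exists>G. continuous_on (closure \<Omega>) G \<and> (\<forall>x\<in>\<Omega>. G x = grad u x) \<and>
          (\<forall>x\<in>frontier \<Omega>. G x \<bullet> outward_unit_normal \<Omega> x + \<beta> x * u x = 0))"

text \<open>
  The principal eigenvalue is treated as a relation between the data and the number \<open>\<sigma>\<close>, so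
  that neither its existence nor its uniqueness is presupposed.
\<close>

definition is_principal_eigenvalue ::
  "(real^'n::finite \<Rightarrow> real) \<Rightarrow> (real^'n) set \<Rightarrow> real \<Rightarrow> bool" where
  "is_principal_eigenvalue \<beta> \<Omega> \<sigma> \<longleftrightarrow> (\<exists>u. positive_eigenfunction \<beta> \<Omega> \<sigma> u)"

end

theory Submission
  imports Defs
begin

text \<open>
  Both limits follow from a single application of the maximum principle, without integration over
  the domain or its boundary.  Let \<open>u\<close> be a positive eigenfunction, \<open>v = ln u\<close>, and write
  \<open>\<Delta>v = - \<sigma> - |\<nabla>v|\<^sup>2\<close>; on the boundary \<open>\<partial>v/\<partial>n = - \<beta>\<close>.  Put \<open>s = -1\<close> if \<open>\<beta>\<close> is bounded below by a
  positive constant \<open>b\<close>, and \<open>s = 1\<close> if \<open>\<beta>\<close> is bounded above by \<open>- b\<close>.  For a smooth function \<open>\<psi>\<close>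
  with \<open>|\<nabla>\<psi>| < b\<close>, the function \<open>s v - \<psi>\<close> has a positive outward derivative at the boundary.  Its
  minimum over the closure is therefore interior, and comparing gradients and Laplacians there
  yields \<open>- s \<sigma> \<ge> \<Delta>\<psi> - |\<nabla>\<psi>|\<^sup>2\<close> (lemma \<open>eigenvalue_comparison\<close>).

  It remains to find \<open>\<psi>\<close> with \<open>|\<nabla>\<psi>|\<close> below \<open>b\<close> and \<open>\<Delta>\<psi>\<close> as large as desired on the domain, and this
  is where smallness of the measure enters.  The Newton potential of a set \<open>K\<close> has constant
  Laplacian in the interior of \<open>K\<close>, while its gradient is bounded by a multiple of \<open>\<integral> |x - y|\<^bsup>1-N\<^esup> dy\<close> over \<open>K\<close>,
  which tends to \<open>0\<close> with \<open>|K|\<close>, whatever the shape of \<open>K\<close>.  A suitable multiple of it is as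
  required.  To have a smooth function given by a finite sum, the
  potential is replaced by a sum of regularised point potentials over a maximal separated subset of
  \<open>K\<close> (theorem \<open>small_gradient_potential\<close>), taken for \<open>K\<close> the closure of the domain.  The closure
  has the same measure as the domain, because the boundary is locally a graph.

  Two further points concern the boundary.  The outward unit normal, defined by a description, has
  to be identified with minus the normalised gradient of a local defining function
  (\<open>outward_unit_normal_eq\<close>).  And the logarithm requires \<open>u > 0\<close> on the closure; this is a
  consequence of Hopf's boundary lemma (\<open>hopf_lemma\<close>), since the Robin condition makes the normal
  derivative vanish wherever \<open>u\<close> does.
\<close>

section \<open>Gradients, Laplacians and interior minima\<close>

text \<open>
  A function is carried together with its gradient \<open>g\<close> and its Laplacian \<open>l\<close>, the latter as the
  trace of the derivative of \<open>g\<close>.  In this form the two quantities that a maximum principle needs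
  obey calculus rules that involve no coordinates, in particular the chain rule
  \<open>has_grad_lap_compose\<close> below, and barriers can be assembled from simple pieces.
\<close>

definition has_grad_lap ::
  "(real^'n::finite \<Rightarrow> real) \<Rightarrow> (real^'n \<Rightarrow> real^'n) \<Rightarrow> (real^'n \<Rightarrow> real) \<Rightarrow> (real^'n) set \<Rightarrow> bool" where
  "has_grad_lap f g l S \<longleftrightarrow> (\<forall>x\<in>S. (f has_derivative (\<lambda>v. g x \<bullet> v)) (at x) \<and>
     (\<exists>H. (g has_derivative H) (at x) \<and> l x = (\<Sum>i\<in>UNIV. H (axis i 1) $ i)))"

lemma has_grad_lapD:
  assumes "has_grad_lap f g l S" "x \<in> S"
  shows "(f has_derivative (\<lambda>v. g x \<bullet> v)) (at x)"
    and "\<exists>H. (g has_derivative H) (at x) \<and> l x = (\<Sum>i\<in>UNIV. H (axis i 1) $ i)"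
  using assms by (auto simp: has_grad_lap_def)

lemma has_grad_lap_continuous_on:
  assumes "has_grad_lap f g l S"
  shows "continuous_on S f" "continuous_on S g"
  using assms unfolding has_grad_lap_def
  by (meson continuous_at_imp_continuous_on has_derivative_continuous)+

lemma has_grad_lap_subset:
  "has_grad_lap f g l S \<Longrightarrow> T \<subseteq> S \<Longrightarrow> has_grad_lap f g l T"
  by (auto simp: has_grad_lap_def)

lemma has_derivative_grad:
  assumes "f differentiable (at x)"
  shows "(f has_derivative (\<lambda>v. grad f x \<bullet> v)) (at x)"
proof -
  let ?D = "frechet_derivative f (at x)"
  have D: "(f has_derivative ?D) (at x)" using assms by (simp add: frechet_derivative_works)
  then interpret linear ?D by (rule has_derivative_linear)
  have "?D v = grad f x \<bullet> v" for v
  proof -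
    have "?D v = ?D (\<Sum>i\<in>UNIV. v $ i *\<^sub>R axis i 1)" using basis_expansion[of v] by (simp only: scalar_mult_eq_scaleR)
    also have "\<dots> = grad f x \<bullet> v"
      by (simp add: sum scale inner_vec_def grad_def partial_deriv_def mult.commute)
    finally show ?thesis .
  qed
  then have "?D = (\<lambda>v. grad f x \<bullet> v)" by auto
  then show ?thesis using D by simp
qed

lemma C2_on_has_grad_lap:
  assumes "C2_on S f"
  shows "has_grad_lap f (grad f) (laplacian f) S"
  unfolding has_grad_lap_def
proof (intro ballI conjI)
  fix x assume x: "x \<in> S"
  show "(f has_derivative (\<lambda>v. grad f x \<bullet> v)) (at x)"
    using assms x by (intro has_derivative_grad) (auto simp: C2_on_def C1_on_def)
  let ?H = "\<lambda>v. \<chi> i. grad (partial_deriv i f) x \<bullet> v"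
  have "((\<lambda>y. \<chi> i. partial_deriv i f y) has_derivative ?H) (at x)"
    using assms x 
    by (subst has_derivative_componentwise_within)
       (auto simp: C2_on_def C1_on_def Basis_vec_def inner_axis intro!: has_derivative_grad)
  then have "(grad f has_derivative ?H) (at x)" by (simp add: grad_def[abs_def])
  moreover have "laplacian f x = (\<Sum>i\<in>UNIV. ?H (axis i 1) $ i)"
    by (simp add: laplacian_def inner_axis grad_def)
  ultimately show "\<exists>H. (grad f has_derivative H) (at x) \<and> laplacian f x = (\<Sum>i\<in>UNIV. H (axis i 1) $ i)"
    by blast
qed

lemma has_grad_lap_add:
  assumes "has_grad_lap f g l S" "has_grad_lap f' g' l' S"
  shows "has_grad_lap (\<lambda>x. f x + f' x) (\<lambda>x. g x + g' x) (\<lambda>x. l x + l' x) S"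
  unfolding has_grad_lap_def
proof (intro ballI conjI)
  fix x assume x: "x \<in> S"
  show "((\<lambda>x. f x + f' x) has_derivative (\<lambda>v. (g x + g' x) \<bullet> v)) (at x)"
    using has_derivative_add[OF has_grad_lapD(1)[OF assms(1) x] has_grad_lapD(1)[OF assms(2) x]]
    by (simp add: inner_add_left)
  obtain H H' where "(g has_derivative H) (at x)" "l x = (\<Sum>i\<in>UNIV. H (axis i 1) $ i)"
    "(g' has_derivative H') (at x)" "l' x = (\<Sum>i\<in>UNIV. H' (axis i 1) $ i)"
    using has_grad_lapD(2)[OF assms(1) x] has_grad_lapD(2)[OF assms(2) x] by blast
  then show "\<exists>H. ((\<lambda>x. g x + g' x) has_derivative H) (at x) \<and> l x + l' x = (\<Sum>i\<in>UNIV. H (axis i 1) $ i)"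
    by (intro exI[of _ "\<lambda>v. H v + H' v"]) (auto intro: has_derivative_add simp: sum.distrib)
qed

lemma has_grad_lap_compose:
  assumes f: "has_grad_lap f g l S"
    and F: "\<And>x. x \<in> S \<Longrightarrow> (F has_real_derivative F' (f x)) (at (f x))"
    and F': "\<And>x. x \<in> S \<Longrightarrow> (F' has_real_derivative F'' (f x)) (at (f x))"
  shows "has_grad_lap (\<lambda>x. F (f x)) (\<lambda>x. F' (f x) *\<^sub>R g x)
           (\<lambda>x. F' (f x) * l x + F'' (f x) * (g x \<bullet> g x)) S"
  unfolding has_grad_lap_def
proof (intro ballI conjI)
  fix x assume x: "x \<in> S"
  note Df = has_grad_lapD(1)[OF f x]
  show "((\<lambda>x. F (f x)) has_derivative (\<lambda>v. (F' (f x) *\<^sub>R g x) \<bullet> v)) (at x)"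
    using has_derivative_compose[OF Df F[OF x, unfolded has_field_derivative_def]] by simp
  obtain H where H: "(g has_derivative H) (at x)" "l x = (\<Sum>i\<in>UNIV. H (axis i 1) $ i)"
    using has_grad_lapD(2)[OF f x] by blast
  have "((\<lambda>x. F' (f x)) has_derivative (\<lambda>v. F'' (f x) * (g x \<bullet> v))) (at x)"
    using has_derivative_compose[OF Df F'[OF x, unfolded has_field_derivative_def]] by simp
  from has_derivative_scaleR[OF this H(1)]
  have D: "((\<lambda>x. F' (f x) *\<^sub>R g x) has_derivative
     (\<lambda>v. F' (f x) *\<^sub>R H v + (F'' (f x) * (g x \<bullet> v)) *\<^sub>R g x)) (at x)" .
  have gg: "g x \<bullet> g x = (\<Sum>i\<in>UNIV. g x $ i * g x $ i)"
    by (simp add: inner_vec_def)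
  have "F' (f x) * l x + F'' (f x) * (g x \<bullet> g x) =
     (\<Sum>i\<in>UNIV. (F' (f x) *\<^sub>R H (axis i 1) + (F'' (f x) * (g x \<bullet> axis i 1)) *\<^sub>R g x) $ i)"
    using gg by (simp add: H(2) sum.distrib sum_distrib_left inner_axis mult.assoc)
  with D show "\<exists>H. ((\<lambda>x. F' (f x) *\<^sub>R g x) has_derivative H) (at x) \<and>
     F' (f x) * l x + F'' (f x) * (g x \<bullet> g x) = (\<Sum>i\<in>UNIV. H (axis i 1) $ i)"
    by blast
qed

lemma has_grad_lap_const: "has_grad_lap (\<lambda>x. c) (\<lambda>x. 0) (\<lambda>x. 0) S"
  unfolding has_grad_lap_def
  by (auto intro!: exI[of _ "\<lambda>v. 0"] simp: inner_zero_left[abs_def])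

lemma has_grad_lap_cmult:
  assumes "has_grad_lap f g l S"
  shows "has_grad_lap (\<lambda>x. c * f x) (\<lambda>x. c *\<^sub>R g x) (\<lambda>x. c * l x) S"
  using has_grad_lap_compose[OF assms, of "\<lambda>t. c * t" "\<lambda>t. c" "\<lambda>t. 0"]
  by (auto intro!: derivative_eq_intros)

lemma has_grad_lap_diff:
  assumes "has_grad_lap f g l S" "has_grad_lap f' g' l' S"
  shows "has_grad_lap (\<lambda>x. f x - f' x) (\<lambda>x. g x - g' x) (\<lambda>x. l x - l' x) S"
  using has_grad_lap_add[OF assms(1) has_grad_lap_cmult[OF assms(2), of "-1"]] by simp

lemma has_grad_lap_sum:
  assumes "finite Y" "\<And>y. y \<in> Y \<Longrightarrow> has_grad_lap (f y) (g y) (l y) S"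
  shows "has_grad_lap (\<lambda>x. \<Sum>y\<in>Y. f y x) (\<lambda>x. \<Sum>y\<in>Y. g y x) (\<lambda>x. \<Sum>y\<in>Y. l y x) S"
  using assms
  by (induction Y rule: finite_induct) (auto intro!: has_grad_lap_const has_grad_lap_add)

lemma has_grad_lap_linear: "has_grad_lap (\<lambda>x. x \<bullet> e) (\<lambda>x. e) (\<lambda>x. 0) S"
  unfolding has_grad_lap_def
  by (auto intro!: exI[of _ "\<lambda>v. 0"] derivative_eq_intros simp: inner_commute)

lemma has_grad_lap_sqdist:
  fixes y :: "real^'n::finite"
  shows "has_grad_lap (\<lambda>x. (x - y) \<bullet> (x - y)) (\<lambda>x. 2 *\<^sub>R (x - y)) (\<lambda>x. 2 * real CARD('n)) S"
  unfolding has_grad_lap_def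
  by (auto intro!: exI[of _ "\<lambda>v. 2 *\<^sub>R v"] derivative_eq_intros
        simp: inner_commute algebra_simps axis_def)

text \<open>
  If \<open>p'\<close> vanishes at \<open>0\<close> and had a negative derivative there, it would be negative just to the
  right of \<open>0\<close>, so that \<open>p\<close> would drop below \<open>p 0\<close>.
\<close>

lemma second_derivative_test_min:
  fixes p :: "real \<Rightarrow> real"
  assumes p: "\<forall>\<^sub>F t in nhds 0. (p has_real_derivative p' t) (at t)"
    and p': "(p' has_real_derivative d) (at 0)"
    and min: "\<forall>\<^sub>F t in nhds 0. p 0 \<le> p t"
  shows "p' 0 = 0" "d \<ge> 0"
proof -
  obtain \<delta> where \<delta>: "\<delta> > 0" "\<And>t. \<bar>t\<bar> < \<delta> \<Longrightarrow> (p has_real_derivative p' t) (at t)"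
      "\<And>t. \<bar>t\<bar> < \<delta> \<Longrightarrow> p 0 \<le> p t"
    using eventually_conj[OF p min] by (auto simp: eventually_nhds_metric dist_real_def)
  show 0: "p' 0 = 0"
    using DERIV_local_min[of p "p' 0" 0 \<delta>] \<delta> by auto
  show "d \<ge> 0"
  proof (rule ccontr)
    assume "\<not> d \<ge> 0"
    then have "d < 0" by simp
    from DERIV_neg_dec_right[OF p' this] obtain \<epsilon> where
      \<epsilon>: "\<epsilon> > 0" "\<And>h. h > 0 \<Longrightarrow> h < \<epsilon> \<Longrightarrow> p' h < 0" using 0 by auto
    define m where "m = min \<delta> \<epsilon> / 2"
    have m: "m > 0" "m < \<delta>" "m < \<epsilon>" using \<delta>(1) \<epsilon>(1) by (auto simp: m_def)
    obtain z where z: "0 < z" "z < m" "p m - p 0 = (m - 0) * p' z"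
      using MVT2[of 0 m p p'] m \<delta>(2) by fastforce
    then have "p m < p 0" using \<epsilon>(2)[of z] m
      by (metis diff_0_right diff_less_0_iff_less less_trans mult_pos_neg)
    then show False using \<delta>(3)[of m] m by auto
  qed
qed

text \<open>
  The one-dimensional test along each coordinate line; the Laplacian is the sum of the second
  derivatives along these lines.
\<close>

lemma has_grad_lap_local_min:
  assumes f: "has_grad_lap f g l S" and S: "open S" "x \<in> S"
    and min: "\<forall>\<^sub>F y in nhds x. f x \<le> f y"
  shows "g x = 0" "l x \<ge> 0"
proof -
  obtain H where H: "(g has_derivative H) (at x)" "l x = (\<Sum>i\<in>UNIV. H (axis i 1) $ i)"
    using has_grad_lapD(2)[OF f S(2)] by blast
  have *: "g x $ i = 0 \<and> H (axis i 1) $ i \<ge> 0" for i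
  proof -
    let ?c = "\<lambda>t::real. x + t *\<^sub>R axis i 1"
    have c: "((\<lambda>t. ?c t) has_derivative (\<lambda>t. t *\<^sub>R axis i 1)) (at t)" for t
      by (auto intro!: derivative_eq_intros)
    have lim: "(?c \<longlongrightarrow> x) (nhds 0)"
      by (rule tendsto_eq_intros filterlim_ident | simp)+
    have der: "\<forall>\<^sub>F t in nhds 0. ((\<lambda>t. f (?c t)) has_real_derivative g (?c t) $ i) (at t)"
      using topological_tendstoD[OF lim S]
    proof eventually_elim
      case (elim t)
      from has_derivative_compose[OF c has_grad_lapD(1)[OF f elim]]
      show ?case by (simp add: has_field_derivative_def inner_axis mult.commute[of _ "g _ $ _"])
    qed
    have H0: "(g has_derivative H) (at (?c 0))" using H by simp
    have "((\<lambda>t. g (?c t)) has_derivative (\<lambda>t. H (t *\<^sub>R axis i 1))) (at 0)"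
      by (rule has_derivative_compose[OF c H0])
    then have "((\<lambda>t. g (?c t) $ i) has_derivative (\<lambda>t. H (t *\<^sub>R axis i 1) $ i)) (at 0)"
      by (rule bounded_linear.has_derivative[OF bounded_linear_vec_nth])
    moreover have "linear H" using H(1) by (rule has_derivative_linear)
    ultimately have der2: "((\<lambda>t. g (?c t) $ i) has_real_derivative H (axis i 1) $ i) (at 0)"
      by (simp add: has_field_derivative_def linear_cmul mult_commute_abs)
    have m: "\<forall>\<^sub>F t in nhds 0. f (?c 0) \<le> f (?c t)"
      using filterlim_iff[THEN iffD1, OF lim, rule_format, OF min] by simp
    show ?thesis using second_derivative_test_min[OF der der2 m] by simp
  qed
  then show "g x = 0" by (simp add: vec_eq_iff)
  show "l x \<ge> 0" using * H(2) by (simp add: sum_nonneg)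
qed

section \<open>The boundary and its normal\<close>

text \<open>
  The function \<open>w\<close> need not be differentiable at the boundary point \<open>z\<close>, only its gradient field
  \<open>W\<close> extends continuously to it.  So the derivative is taken at interior points of the inward
  segment from \<open>z\<close>: if \<open>W z \<bullet> \<nu>\<close> were positive, \<open>w\<close> would strictly decrease along that segment by the
  mean value theorem, and \<open>z\<close> would not be a minimum.
\<close>

lemma boundary_min_normal_derivative:
  fixes w :: "real^'n::finite \<Rightarrow> real"
  assumes z: "z \<in> closure \<Omega>" and \<rho>: "\<rho> > 0"
    and inward: "\<forall>\<^sub>F t in at_right 0. z - t *\<^sub>R \<nu> \<in> \<Omega>"
    and w: "continuous_on (closure \<Omega> \<inter> ball z \<rho>) w"
    and W: "continuous_on (closure \<Omega> \<inter> ball z \<rho>) W"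
    and der: "\<And>x. x \<in> \<Omega> \<inter> ball z \<rho> \<Longrightarrow> (w has_derivative (\<lambda>v. W x \<bullet> v)) (at x)"
    and min: "\<And>x. x \<in> \<Omega> \<inter> ball z \<rho> \<Longrightarrow> w z \<le> w x"
  shows "W z \<bullet> \<nu> \<le> 0"
proof (rule ccontr)
  assume "\<not> W z \<bullet> \<nu> \<le> 0"
  then have pos: "W z \<bullet> \<nu> > 0" by simp
  let ?c = "\<lambda>t::real. z - t *\<^sub>R \<nu>"
  have lim: "(?c \<longlongrightarrow> z) (at_right 0)"
    by (rule tendsto_eq_intros filterlim_ident | simp)+
  have ev: "\<forall>\<^sub>F t in at_right 0. ?c t \<in> \<Omega> \<inter> ball z \<rho>"
    using inward topological_tendstoD[OF lim open_ball, of z \<rho>] \<rho>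
    by (auto intro: eventually_conj)
  have "((\<lambda>x. W x \<bullet> \<nu>) \<longlongrightarrow> W z \<bullet> \<nu>) (at z within closure \<Omega> \<inter> ball z \<rho>)"
    using W z \<rho> by (intro tendsto_inner tendsto_const) (auto simp: continuous_on_def)
  moreover have "filterlim ?c (at z within closure \<Omega> \<inter> ball z \<rho>) (at_right 0)"
    unfolding filterlim_at
  proof (intro conjI lim)
    have \<nu>: "\<nu> \<noteq> 0" using pos by auto
    show "\<forall>\<^sub>F t in at_right 0. ?c t \<in> closure \<Omega> \<inter> ball z \<rho> \<and> ?c t \<noteq> z"
      using ev eventually_at_right_less[of "0::real"] 
      by eventually_elim (use \<nu> in \<open>auto intro: subsetD[OF closure_subset]\<close>)
  qed
  ultimately have "((\<lambda>t. W (?c t) \<bullet> \<nu>) \<longlongrightarrow> W z \<bullet> \<nu>) (at_right 0)"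
    by (rule filterlim_compose)
  from order_tendstoD(1)[OF this pos] ev
  have "\<forall>\<^sub>F t in at_right 0. 0 < W (?c t) \<bullet> \<nu> \<and> ?c t \<in> \<Omega> \<inter> ball z \<rho>"
    by eventually_elim auto
  then obtain \<tau> where \<tau>: "\<tau> > 0" "\<And>t. 0 < t \<Longrightarrow> t < \<tau> \<Longrightarrow> 0 < W (?c t) \<bullet> \<nu> \<and> ?c t \<in> \<Omega> \<inter> ball z \<rho>"
    by (auto simp: eventually_at_right_field)
  define m where "m = \<tau> / 2"
  have m: "0 < m" "m < \<tau>" using \<tau>(1) by (auto simp: m_def)
  have sub: "?c ` {0..m} \<subseteq> closure \<Omega> \<inter> ball z \<rho>"
  proof clarify
    fix t assume t: "t \<in> {0..m}"
    show "?c t \<in> closure \<Omega> \<inter> ball z \<rho>"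
    proof (cases "t = 0")
      case False
      then show ?thesis using \<tau>(2)[of t] t m by (auto intro: subsetD[OF closure_subset])
    qed (use z \<rho> in simp)
  qed
  have "continuous_on {0..m} (\<lambda>t. w (?c t))"
    by (rule continuous_on_compose2[OF w _ sub]) (intro continuous_intros)
  moreover have "((\<lambda>t. w (?c t)) has_derivative (\<lambda>s. W (?c t) \<bullet> (- s *\<^sub>R \<nu>))) (at t)" if "0 < t" "t < m" for t
  proof -
    have c: "(?c has_derivative (\<lambda>s. - s *\<^sub>R \<nu>)) (at t)" by (auto intro!: derivative_eq_intros)
    have "?c t \<in> \<Omega> \<inter> ball z \<rho>" using \<tau>(2)[of t] that m by auto
    from has_derivative_compose[OF c der[OF this]] show ?thesis .
  qed
  ultimately obtain \<xi> where \<xi>: "0 < \<xi>" "\<xi> < m" "w (?c m) - w (?c 0) = W (?c \<xi>) \<bullet> (- (m - 0) *\<^sub>R \<nu>)"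
    using mvt[OF m(1), of "\<lambda>t. w (?c t)" "\<lambda>t s. W (?c t) \<bullet> (- s *\<^sub>R \<nu>)"] by auto
  have "0 < m * (W (?c \<xi>) \<bullet> \<nu>)" using \<tau>(2)[of \<xi>] \<xi> m by auto
  then have "w (?c m) < w z" using \<xi>(3) by simp
  then show False using min[of "?c m"] \<tau>(2)[of m] m by auto
qed

text \<open>
  If the domain lies locally above the graph of \<open>g\<close> in direction \<open>e\<close>, then \<open>h x = x \<bullet> e - g x\<close> is a
  defining function: it is positive inside and vanishes on the boundary.  Since \<open>g\<close> is constant
  along \<open>e\<close>, \<open>h\<close> grows with unit speed in that direction, which makes its gradient at least \<open>1\<close> in
  norm at every point of the ball.
\<close>

locale C2_defining_function =
  fixes \<Omega> :: "(real^'n::finite) set" and z :: "real^'n" and r :: real and e :: "real^'n"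
    and h :: "real^'n \<Rightarrow> real" and k :: "real^'n \<Rightarrow> real^'n" and l :: "real^'n \<Rightarrow> real"
  assumes open_domain: "open \<Omega>" and boundary_point: "z \<in> frontier \<Omega>" and radius: "r > 0"
    and unit: "norm e = 1"
    and shift: "h (x + t *\<^sub>R e) = h x + t"
    and grad_lap: "has_grad_lap h k l (ball z r)"
    and cont_lap: "continuous_on (ball z r) l"
    and domain: "\<Omega> \<inter> ball z r = {x \<in> ball z r. 0 < h x}"
begin

lemma cont: "continuous_on (ball z r) h" "continuous_on (ball z r) k"
  using has_grad_lap_continuous_on[OF grad_lap] .

lemma domain_iff: "x \<in> ball z r \<Longrightarrow> x \<in> \<Omega> \<longleftrightarrow> 0 < h x"
  using domain by blast

lemma grad_e:
  assumes "x \<in> ball z r" shows "k x \<bullet> e = 1"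
proof -
  have "((\<lambda>t. x + t *\<^sub>R e) has_derivative (\<lambda>t. t *\<^sub>R e)) (at 0)"
    by (auto intro!: derivative_eq_intros)
  moreover have "(h has_derivative (\<lambda>v. k x \<bullet> v)) (at (x + 0 *\<^sub>R e))"
    using has_grad_lapD(1)[OF grad_lap assms] by simp
  ultimately have "((\<lambda>t. h (x + t *\<^sub>R e)) has_derivative (\<lambda>t. k x \<bullet> (t *\<^sub>R e))) (at 0)"
    by (rule has_derivative_compose)
  moreover have "((\<lambda>t. h (x + t *\<^sub>R e)) has_derivative (\<lambda>t. t)) (at 0)"
    unfolding shift by (auto intro!: derivative_eq_intros)
  ultimately have "(\<lambda>t. k x \<bullet> (t *\<^sub>R e)) = (\<lambda>t. t)" by (rule has_derivative_unique)
  from fun_cong[OF this, of 1] show ?thesis by simp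
qed

lemma grad_sq_ge_1:
  assumes "x \<in> ball z r" shows "1 \<le> k x \<bullet> k x"
proof -
  have "1 \<le> norm (k x)" using norm_cauchy_schwarz[of "k x" e] grad_e[OF assms] unit by simp
  then have "1\<^sup>2 \<le> (norm (k x))\<^sup>2" by (intro power_mono) auto
  then show ?thesis by (simp add: power2_norm_eq_inner)
qed

lemma closure_iff:
  assumes x: "x \<in> ball z r" shows "x \<in> closure \<Omega> \<longleftrightarrow> 0 \<le> h x"
proof
  assume cl: "x \<in> closure \<Omega>"
  show "0 \<le> h x"
  proof (rule ccontr)
    assume "\<not> 0 \<le> h x"
    then have "h x < 0" by simp
    have "open (ball z r \<inter> h -` {..<0})"
      by (rule continuous_open_preimage) (use cont in auto)
    moreover have "(ball z r \<inter> h -` {..<0}) \<inter> \<Omega> = {}" using domain_iff by fastforce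
    ultimately have "(ball z r \<inter> h -` {..<0}) \<inter> closure \<Omega> = {}"
      by (simp add: open_Int_closure_eq_empty)
    then show False using x cl \<open>h x < 0\<close> by auto
  qed
next
  assume "0 \<le> h x"
  have lim: "((\<lambda>t. x + t *\<^sub>R e) \<longlongrightarrow> x) (at_right 0)"
    by (rule tendsto_eq_intros filterlim_ident | simp)+
  have "\<forall>\<^sub>F t in at_right 0. x + t *\<^sub>R e \<in> \<Omega>"
    using topological_tendstoD[OF lim open_ball x] eventually_at_right_less[of "0::real"]
    by eventually_elim (use \<open>0 \<le> h x\<close> in \<open>simp add: domain_iff shift\<close>)
  then show "x \<in> closure \<Omega>"
    using Lim_in_closed_set[OF closed_closure _ _ lim, of \<Omega>]
    by (metis (mono_tags, lifting) closure_subset eventually_mono subsetD trivial_limit_at_right_real)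
qed

lemma frontier_iff:
  assumes x: "x \<in> ball z r" shows "x \<in> frontier \<Omega> \<longleftrightarrow> h x = 0"
  using closure_iff[OF x] domain_iff[OF x] open_domain by (auto simp: frontier_def interior_open)

lemma zero: "h z = 0"
  using frontier_iff boundary_point radius by auto

lemma grad_nonzero: "k z \<noteq> 0"
  using grad_sq_ge_1[of z] radius by auto

lemma line_tendsto: "((\<lambda>t. z + t *\<^sub>R w) \<longlongrightarrow> z) (nhds (0::real))"
  by (rule tendsto_eq_intros filterlim_ident | simp)+

lemma derivative_along_line: "((\<lambda>t. h (z + t *\<^sub>R w)) has_real_derivative k z \<bullet> w) (at 0)"
proof -
  have "((\<lambda>t. z + t *\<^sub>R w) has_derivative (\<lambda>t. t *\<^sub>R w)) (at 0)"
    by (auto intro!: derivative_eq_intros)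
  moreover have "(h has_derivative (\<lambda>v. k z \<bullet> v)) (at (z + 0 *\<^sub>R w))"
    using has_grad_lapD(1)[OF grad_lap, of z] radius by simp
  ultimately have "((\<lambda>t. h (z + t *\<^sub>R w)) has_derivative (\<lambda>t. k z \<bullet> (t *\<^sub>R w))) (at 0)"
    by (rule has_derivative_compose)
  then show ?thesis by (simp add: has_field_derivative_def mult_commute_abs)
qed

lemma enters_domain:
  assumes "0 < k z \<bullet> w"
  shows "\<forall>\<^sub>F t in at_right 0. z + t *\<^sub>R w \<in> \<Omega>"
proof -
  obtain d where d: "d > 0" "\<And>t. 0 < t \<Longrightarrow> t < d \<Longrightarrow> 0 < h (z + t *\<^sub>R w)"
    using DERIV_pos_inc_right[OF derivative_along_line assms] zero by auto
  have "\<forall>\<^sub>F t in at_right 0. z + t *\<^sub>R w \<in> ball z r"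
    using topological_tendstoD[OF line_tendsto open_ball, of z r w] radius
    by (simp add: eventually_nhds_conv_at eventually_at_split)
  moreover have "\<forall>\<^sub>F t in at_right 0. 0 < h (z + t *\<^sub>R w)"
    using d by (auto simp: eventually_at_right_field)
  ultimately show ?thesis by eventually_elim (simp add: domain_iff)
qed

lemma leaves_closure:
  assumes "k z \<bullet> w < 0"
  shows "\<forall>\<^sub>F t in at_right 0. z + t *\<^sub>R w \<notin> closure \<Omega>"
proof -
  obtain d where d: "d > 0" "\<And>t. 0 < t \<Longrightarrow> t < d \<Longrightarrow> h (z + t *\<^sub>R w) < 0"
    using DERIV_neg_dec_right[OF derivative_along_line assms] zero by auto
  have "\<forall>\<^sub>F t in at_right 0. z + t *\<^sub>R w \<in> ball z r"
    using topological_tendstoD[OF line_tendsto open_ball, of z r w] radius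
    by (simp add: eventually_nhds_conv_at eventually_at_split)
  moreover have "\<forall>\<^sub>F t in at_right 0. h (z + t *\<^sub>R w) < 0"
    using d by (auto simp: eventually_at_right_field)
  ultimately show ?thesis by eventually_elim (simp add: closure_iff)
qed

text \<open>
  A vector \<open>v\<close> orthogonal to the gradient is tangent because the line \<open>z + t v\<close> can be pushed back
  to the boundary along \<open>e\<close>: moving by \<open>- h (z + t v)\<close> lands exactly on the zero set of \<open>h\<close>, and
  this correction has derivative \<open>0\<close> at \<open>t = 0\<close>.
\<close>

lemma tangent_vectors_eq: "tangent_vectors (frontier \<Omega>) z = {v. k z \<bullet> v = 0}"
proof (intro set_eqI iffI)
  fix v assume "v \<in> tangent_vectors (frontier \<Omega>) z"
  then obtain c where c: "c 0 = z" "\<forall>\<^sub>F t in nhds 0. c t \<in> frontier \<Omega>" "(c has_vector_derivative v) (at 0)"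
    by (auto simp: tangent_vectors_def)
  have "(c \<longlongrightarrow> c 0) (nhds 0)"
    using has_vector_derivative_continuous[OF c(3)] by (simp add: continuous_at tendsto_at_iff_tendsto_nhds)
  then have "\<forall>\<^sub>F t in nhds 0. c t \<in> ball z r"
    using topological_tendstoD[of c "c 0" "nhds 0" "ball z r"] c(1) radius by auto
  with c(2) have ev: "\<forall>\<^sub>F t in nhds 0. h (c t) = 0"
    by eventually_elim (simp add: frontier_iff)
  have "(h has_derivative (\<lambda>v. k z \<bullet> v)) (at (c 0))"
    using has_grad_lapD(1)[OF grad_lap, of z] radius c(1) by simp
  from has_derivative_compose[OF c(3)[unfolded has_vector_derivative_def] this]
  have "((\<lambda>t. h (c t)) has_derivative (\<lambda>t. k z \<bullet> (t *\<^sub>R v))) (at 0)" .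
  moreover have "((\<lambda>t. h (c t)) has_derivative (\<lambda>t. 0)) (at 0)"
    by (rule has_derivative_transform_eventually[of "\<lambda>t. 0", OF has_derivative_const])
       (use ev eventually_nhds_x_imp_x[OF ev] in \<open>auto simp: eventually_nhds_conv_at elim: eventually_mono\<close>)
  ultimately have "(\<lambda>t. k z \<bullet> (t *\<^sub>R v)) = (\<lambda>t. 0)" by (rule has_derivative_unique)
  from fun_cong[OF this, of 1] show "v \<in> {v. k z \<bullet> v = 0}" by simp
next
  fix v assume "v \<in> {v. k z \<bullet> v = 0}"
  then have v: "k z \<bullet> v = 0" by simp
  define c where "c t = z + t *\<^sub>R v + (- h (z + t *\<^sub>R v)) *\<^sub>R e" for t :: real
  have c0: "c 0 = z" by (simp add: c_def zero)
  have "(c has_vector_derivative (v + (- 0) *\<^sub>R e)) (at 0)"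
    unfolding c_def 
    by (auto intro!: derivative_eq_intros derivative_along_line[of v, unfolded v] simp: has_real_derivative_iff_has_vector_derivative[symmetric])
  then have der: "(c has_vector_derivative v) (at 0)" by simp
  have "(c \<longlongrightarrow> c 0) (nhds 0)"
    using has_vector_derivative_continuous[OF der] by (simp add: continuous_at tendsto_at_iff_tendsto_nhds)
  then have "\<forall>\<^sub>F t in nhds 0. c t \<in> ball z r"
    using topological_tendstoD[of c "c 0" "nhds 0" "ball z r"] c0 radius by auto
  moreover have "h (c t) = 0" for t unfolding c_def shift by simp
  ultimately have "\<forall>\<^sub>F t in nhds 0. c t \<in> frontier \<Omega>"
    by (auto simp: frontier_iff elim: eventually_mono)
  then show "v \<in> tangent_vectors (frontier \<Omega>) z"
    using c0 der by (auto simp: tangent_vectors_def)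
qed

text \<open>
  Orthogonality to the tangent space leaves the two unit vectors parallel to the gradient, and
  only the one along which \<open>h\<close> decreases leads out of the closure.
\<close>

lemma outward_unit_normal_eq: "outward_unit_normal \<Omega> z = - (k z /\<^sub>R norm (k z))"
  unfolding outward_unit_normal_def tangent_vectors_eq
proof (rule the_equality)
  let ?n = "- (k z /\<^sub>R norm (k z))"
  have "k z \<bullet> ?n < 0" using grad_nonzero by simp
  then show "norm ?n = 1 \<and> (\<forall>v\<in>{v. k z \<bullet> v = 0}. ?n \<bullet> v = 0) \<and>
      (\<forall>\<^sub>F t in at_right 0. z + t *\<^sub>R ?n \<notin> closure \<Omega>)"
    using leaves_closure[of ?n] grad_nonzero by simp
next
  fix \<nu> assume \<nu>: "norm \<nu> = 1 \<and> (\<forall>v\<in>{v. k z \<bullet> v = 0}. \<nu> \<bullet> v = 0) \<and>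
      (\<forall>\<^sub>F t in at_right 0. z + t *\<^sub>R \<nu> \<notin> closure \<Omega>)"
  define a where "a = (k z \<bullet> \<nu>) / (k z \<bullet> k z)"
  define v where "v = \<nu> - a *\<^sub>R k z"
  have "k z \<bullet> v = 0" using grad_nonzero by (simp add: v_def a_def inner_diff_right)
  with \<nu> have "\<nu> \<bullet> v = 0" by blast
  then have "v \<bullet> v = 0" using \<open>k z \<bullet> v = 0\<close> by (simp add: v_def inner_diff_left)
  then have \<nu>a: "\<nu> = a *\<^sub>R k z" by (simp add: v_def)
  then have abs: "\<bar>a\<bar> * norm (k z) = 1" using \<nu> by simp
  have "\<not> 0 < k z \<bullet> \<nu>"
  proof
    assume "0 < k z \<bullet> \<nu>"
    from enters_domain[OF this] conjunct2[OF conjunct2[OF \<nu>]]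
    have "\<forall>\<^sub>F t::real in at_right 0. False"
      by eventually_elim (auto dest: subsetD[OF closure_subset])
    then show False by simp
  qed
  then have "a \<le> 0" using grad_nonzero by (simp add: \<nu>a zero_less_mult_iff)
  then have "a = - inverse (norm (k z))" using abs grad_nonzero by (simp add: field_simps)
  then show "\<nu> = - (k z /\<^sub>R norm (k z))" using \<nu>a by simp
qed

lemma inward_normal: "\<forall>\<^sub>F t in at_right 0. z - t *\<^sub>R outward_unit_normal \<Omega> z \<in> \<Omega>"
  using enters_domain[of "- outward_unit_normal \<Omega> z"] grad_nonzero
  by (simp add: outward_unit_normal_eq)

end

lemma C2_defining_function_exists:
  fixes \<Omega> :: "(real^'n::finite) set"
  assumes "open \<Omega>" "C2_holder_boundary \<alpha> \<Omega>" "z \<in> frontier \<Omega>"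
  obtains r e h k l where "C2_defining_function \<Omega> z r e h k l"
proof -
  from assms obtain r e g where *: "r > 0" "norm e = 1" "\<And>x t. g (x + t *\<^sub>R e) = g x"
    "C2_holder_on \<alpha> (ball z r) g" "\<Omega> \<inter> ball z r = {x \<in> ball z r. g x < x \<bullet> e}"
    unfolding C2_holder_boundary_def by meson
  have C2: "C2_on (ball z r) g" using * by (simp add: C2_holder_on_def)
  have cl: "continuous_on (ball z r) (laplacian g)"
    using C2 unfolding laplacian_def[abs_def] C2_on_def C1_on_def by (intro continuous_on_sum) auto
  have "C2_defining_function \<Omega> z r e (\<lambda>x. x \<bullet> e - g x) (\<lambda>x. e - grad g x) (\<lambda>x. 0 - laplacian g x)"
  proof
    show "has_grad_lap (\<lambda>x. x \<bullet> e - g x) (\<lambda>x. e - grad g x) (\<lambda>x. 0 - laplacian g x) (ball z r)"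
      by (intro has_grad_lap_diff has_grad_lap_linear C2_on_has_grad_lap C2)
    show "continuous_on (ball z r) (\<lambda>x. 0 - laplacian g x)"
      by (intro continuous_intros cl)
    show "(x + t *\<^sub>R e) \<bullet> e - g (x + t *\<^sub>R e) = x \<bullet> e - g x + t" for x t
      using * by (simp add: inner_add_left dot_square_norm)
  qed (use assms * in auto)
  then show ?thesis by (rule that)
qed

section \<open>Positivity up to the boundary\<close>

context C2_defining_function
begin

text \<open>
  This is Hopf's boundary lemma.  The defining function itself supplies the barrier:
  \<open>\<phi> = exp (a h) - 1 - |x - z|\<^sup>2\<close> vanishes at \<open>z\<close>, is at most \<open>0\<close> on the boundary of the domain, has
  a strictly positive derivative in the inward direction, and satisfies \<open>\<Delta>\<phi> > |\<sigma>| \<phi>\<close> for large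
  \<open>a\<close>, because the term \<open>a\<^sup>2 |\<nabla>h|\<^sup>2 exp (a h)\<close> dominates.  On a small ball around \<open>z\<close> a small
  multiple \<open>\<epsilon> \<phi>\<close> stays below \<open>u\<close> by the maximum principle: on the part of the sphere where
  \<open>\<phi> \<ge> 0\<close> the function \<open>u\<close> has a positive minimum.  As \<open>u - \<epsilon> \<phi>\<close> is then minimal at \<open>z\<close>, the
  inward derivative of \<open>u\<close> is at least that of \<open>\<epsilon> \<phi>\<close>.
\<close>

lemma hopf_lemma:
  assumes u: "C2_on \<Omega> u" "continuous_on (closure \<Omega>) u"
    and pos: "\<And>x. x \<in> \<Omega> \<Longrightarrow> 0 < u x"
    and eq: "\<And>x. x \<in> \<Omega> \<Longrightarrow> - laplacian u x = \<sigma> * u x"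
    and G: "continuous_on (closure \<Omega>) G" "\<And>x. x \<in> \<Omega> \<Longrightarrow> G x = grad u x"
    and uz: "u z = 0"
  shows "G z \<bullet> outward_unit_normal \<Omega> z < 0"
proof -
  define \<rho> where "\<rho> = r / 2"
  have \<rho>: "0 < \<rho>" "\<rho> < r" using radius by (auto simp: \<rho>_def)
  have sub: "cball z \<rho> \<subseteq> ball z r" using \<rho> by auto
  define A where "A = {x \<in> cball z \<rho>. 0 \<le> h x}"
  have cont_h: "continuous_on (cball z \<rho>) h" using cont(1) sub continuous_on_subset by blast
  have A_compact: "compact A"
    using continuous_closed_preimage[OF cont_h closed_cball, of "{0..}"]
    unfolding A_def compact_eq_bounded_closed
    by (auto simp: vimage_def Int_def intro: bounded_subset[OF bounded_cball[of z \<rho>]])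
  have A_closure: "A \<subseteq> closure \<Omega>" using closure_iff sub by (auto simp: A_def)
  have inside_A: "x \<in> A" if "x \<in> \<Omega> \<inter> ball z \<rho>" for x
    using that domain_iff[of x] \<rho> by (auto simp: A_def)
  have u_ge0: "0 \<le> u x" if "x \<in> closure \<Omega>" for x
    using continuous_ge_on_closure[OF u(2) that, of 0] pos less_imp_le by blast
  obtain M where M: "0 \<le> M" "\<And>x. x \<in> cball z \<rho> \<Longrightarrow> \<bar>l x\<bar> \<le> M"
  proof -
    have "bounded (l ` cball z \<rho>)"
      using cont_lap sub by (intro compact_imp_bounded compact_continuous_image) (auto intro: continuous_on_subset)
    then obtain M where "\<And>x. x \<in> cball z \<rho> \<Longrightarrow> \<bar>l x\<bar> \<le> M" unfolding bounded_real by blast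
    then show ?thesis using that[of "\<bar>M\<bar>"] by fastforce
  qed
  define N where "N = real CARD('n)"
  \<comment> \<open>Chosen so that \<open>a\<^sup>2 - a M\<close> beats \<open>|\<sigma>|\<close> and the Laplacian \<open>2 N\<close> of \<open>|x - z|\<^sup>2\<close>.\<close>
  define a where "a = 1 + M + 2 * N + \<bar>\<sigma>\<bar>"
  have a: "1 \<le> a" "0 \<le> N" using M by (auto simp: a_def N_def)
  have aM: "1 + 2 * N + \<bar>\<sigma>\<bar> \<le> a * a - a * M"
  proof -
    have "1 * (1 + 2 * N + \<bar>\<sigma>\<bar>) \<le> a * (a - M)"
      using a by (intro mult_mono) (auto simp: a_def N_def)
    then show ?thesis by (simp add: algebra_simps)
  qed
  define \<phi> where "\<phi> x = (exp (a * h x) - 1) - (x - z) \<bullet> (x - z)" for x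
  define \<phi>' where "\<phi>' x = (a * exp (a * h x)) *\<^sub>R k x - 2 *\<^sub>R (x - z)" for x
  define \<phi>'' where "\<phi>'' x = (a * exp (a * h x) * l x + a * a * exp (a * h x) * (k x \<bullet> k x)) - 2 * N" for x
  have \<phi>: "has_grad_lap \<phi> \<phi>' \<phi>'' (ball z r)"
    unfolding \<phi>_def[abs_def] \<phi>'_def[abs_def] \<phi>''_def[abs_def] N_def
    by (intro has_grad_lap_diff has_grad_lap_sqdist
          has_grad_lap_compose[OF grad_lap, where F = "\<lambda>s. exp (a * s) - 1"])
       (auto intro!: derivative_eq_intros)
  have sub_sol: "\<bar>\<sigma>\<bar> * \<phi> x < \<phi>'' x" if x: "x \<in> A" for x
  proof -
    have x': "x \<in> ball z r" "0 \<le> h x" "x \<in> cball z \<rho>" using x sub by (auto simp: A_def)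
    let ?E = "exp (a * h x)"
    have E: "1 \<le> ?E" using a x' by simp
    have "\<bar>\<sigma>\<bar> * \<phi> x \<le> \<bar>\<sigma>\<bar> * ?E" 
      by (intro mult_left_mono) (auto simp: \<phi>_def intro: order_trans[OF _ inner_ge_zero[of "x - z"]])
    also have "\<dots> < \<bar>\<sigma>\<bar> * ?E + ?E + 2 * N * ?E - 2 * N"
    proof -
      have "2 * N * 1 \<le> 2 * N * ?E" using E a by (intro mult_left_mono) auto
      then show ?thesis using E by linarith
    qed
    also have "\<dots> = ?E * (1 + 2 * N + \<bar>\<sigma>\<bar>) - 2 * N" by (simp add: algebra_simps)
    also have "\<dots> \<le> ?E * (a * a - a * M) - 2 * N"
      using aM by (intro diff_right_mono mult_left_mono) auto
    also have "\<dots> \<le> ?E * (a * a * (k x \<bullet> k x) + a * l x) - 2 * N"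
    proof -
      have "a * a * 1 \<le> a * a * (k x \<bullet> k x)"
        using grad_sq_ge_1[OF x'(1)] by (intro mult_left_mono) auto
      moreover have "a * (- l x) \<le> a * M"
        using M(2)[OF x'(3)] a by (intro mult_left_mono) auto
      ultimately have "a * a - a * M \<le> a * a * (k x \<bullet> k x) + a * l x" by simp
      then show ?thesis by (intro diff_right_mono mult_left_mono) auto
    qed
    also have "\<dots> = \<phi>'' x" by (simp add: \<phi>''_def algebra_simps)
    finally show ?thesis .
  qed
  have cont_\<phi>: "continuous_on (ball z r) \<phi>" "continuous_on (ball z r) \<phi>'"
    using has_grad_lap_continuous_on[OF \<phi>] .
  obtain P where P: "0 < P" "\<And>x. x \<in> cball z \<rho> \<Longrightarrow> \<phi> x \<le> P"
  proof -
    have "bounded (\<phi> ` cball z \<rho>)"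
      using cont_\<phi>(1) sub by (intro compact_imp_bounded compact_continuous_image) (auto intro: continuous_on_subset)
    then obtain P where "\<And>x. x \<in> cball z \<rho> \<Longrightarrow> \<bar>\<phi> x\<bar> \<le> P" unfolding bounded_real by blast
    then show ?thesis using that[of "\<bar>P\<bar> + 1"] by fastforce
  qed
  \<comment> \<open>Where \<open>\<phi>\<close> is nonnegative on the sphere, \<open>h\<close> is positive, so this set lies inside the domain.\<close>
  define A1 where "A1 = A \<inter> {x \<in> sphere z \<rho>. 0 \<le> \<phi> x}"
  obtain m where m: "0 < m" "\<And>x. x \<in> A1 \<Longrightarrow> m \<le> u x"
  proof (cases "A1 = {}")
    case True
    then show ?thesis using that[of 1] by auto
  next
    case False
    have "closed (sphere z \<rho> \<inter> \<phi> -` {0..})"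
      using cont_\<phi>(1) \<rho> by (intro continuous_closed_preimage) (auto intro: continuous_on_subset)
    then have "compact A1" unfolding A1_def
      by (intro compact_Int_closed A_compact) (simp add: vimage_def Int_def)
    moreover have "A1 \<subseteq> closure \<Omega>" using A_closure by (auto simp: A1_def)
    ultimately obtain x0 where x0: "x0 \<in> A1" "\<And>x. x \<in> A1 \<Longrightarrow> u x0 \<le> u x"
      using continuous_attains_inf[of A1 u] False continuous_on_subset[OF u(2)] by blast
    have "h x0 \<noteq> 0"
    proof
      assume "h x0 = 0"
      moreover have "x0 \<noteq> z" using x0 \<rho> by (auto simp: A1_def)
      ultimately have "\<phi> x0 < 0" by (simp add: \<phi>_def)
      then show False using x0 by (simp add: A1_def)
    qed
    then have "x0 \<in> \<Omega>" using x0 sub domain_iff[of x0] by (auto simp: A1_def A_def)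
    then show ?thesis using that[of "u x0"] x0 pos by blast
  qed
  define \<epsilon> where "\<epsilon> = m / P"
  have \<epsilon>: "0 < \<epsilon>" using m P by (simp add: \<epsilon>_def)
  define w where "w x = u x - \<epsilon> * \<phi> x" for x
  have interior: "has_grad_lap w (\<lambda>x. grad u x - \<epsilon> *\<^sub>R \<phi>' x) (\<lambda>x. laplacian u x - \<epsilon> * \<phi>'' x) (\<Omega> \<inter> ball z r)"
    unfolding w_def[abs_def]
    by (intro has_grad_lap_diff has_grad_lap_cmult has_grad_lap_subset[OF \<phi>]
        has_grad_lap_subset[OF C2_on_has_grad_lap[OF u(1)]]) auto
  have cont_w: "continuous_on (closure \<Omega> \<inter> ball z r) w"
    unfolding w_def[abs_def]
    by (intro continuous_intros continuous_on_subset[OF u(2)] continuous_on_subset[OF cont_\<phi>(1)]) auto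
  have z_A: "z \<in> A" using \<rho> zero by (simp add: A_def)
  have "A \<subseteq> closure \<Omega> \<inter> ball z r" using A_closure sub by (auto simp: A_def)
  then obtain x0 where x0: "x0 \<in> A" "\<And>x. x \<in> A \<Longrightarrow> w x0 \<le> w x"
    using continuous_attains_inf[OF A_compact _ continuous_on_subset[OF cont_w]] z_A by blast
  have x0_cl: "x0 \<in> closure \<Omega>" "x0 \<in> ball z r" "x0 \<in> cball z \<rho>" "0 \<le> h x0"
    using x0 A_closure sub by (auto simp: A_def)
  have w_pos: "0 \<le> w x0"
  proof (rule ccontr)
    assume "\<not> 0 \<le> w x0"
    then have neg: "u x0 < \<epsilon> * \<phi> x0" by (simp add: w_def)
    then have "0 < \<epsilon> * \<phi> x0" using u_ge0[OF x0_cl(1)] by linarith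
    then have \<phi>0: "0 < \<phi> x0" using \<epsilon> by (simp add: zero_less_mult_iff)
    have "\<phi> x0 \<le> 0" if "h x0 = 0" using that by (simp add: \<phi>_def)
    then have "h x0 \<noteq> 0" using \<phi>0 by linarith
    then have x0_\<Omega>: "x0 \<in> \<Omega>" using x0_cl domain_iff by auto
    have "x0 \<notin> sphere z \<rho>"
    proof
      assume "x0 \<in> sphere z \<rho>"
      then have "x0 \<in> A1" using x0 \<phi>0 by (simp add: A1_def)
      then have "m \<le> u x0" by (rule m)
      moreover have "\<epsilon> * \<phi> x0 \<le> \<epsilon> * P" using P(2) x0_cl \<epsilon> by simp
      moreover have "\<epsilon> * P = m" using P by (simp add: \<epsilon>_def)
      ultimately show False using neg by linarith
    qed
    then have x0_ball: "x0 \<in> ball z \<rho>" using x0_cl by auto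
    have "\<forall>\<^sub>F y in nhds x0. y \<in> \<Omega> \<inter> ball z \<rho>"
      using x0_\<Omega> x0_ball open_domain by (intro eventually_nhds_in_open) auto
    then have loc: "\<forall>\<^sub>F y in nhds x0. w x0 \<le> w y"
      by eventually_elim (blast intro: x0(2) inside_A)
    have "0 \<le> laplacian u x0 - \<epsilon> * \<phi>'' x0"
      by (rule has_grad_lap_local_min(2)[OF interior _ _ loc]) (use open_domain x0_\<Omega> x0_cl in auto)
    moreover have "\<epsilon> * (\<bar>\<sigma>\<bar> * \<phi> x0) < \<epsilon> * \<phi>'' x0" using sub_sol[OF x0(1)] \<epsilon> by simp
    moreover have "laplacian u x0 \<le> \<bar>\<sigma>\<bar> * u x0"
    proof -
      have "- \<sigma> * u x0 \<le> \<bar>\<sigma>\<bar> * u x0" using pos[OF x0_\<Omega>] by (intro mult_right_mono) auto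
      then show ?thesis using eq[OF x0_\<Omega>] by simp
    qed
    moreover have "\<bar>\<sigma>\<bar> * u x0 \<le> \<bar>\<sigma>\<bar> * (\<epsilon> * \<phi> x0)" using neg by (intro mult_left_mono) auto
    ultimately show False by (simp add: algebra_simps)
  qed
  have wz: "w z = 0" by (simp add: w_def \<phi>_def zero uz)
  have "(G z - \<epsilon> *\<^sub>R \<phi>' z) \<bullet> outward_unit_normal \<Omega> z \<le> 0"
  proof (rule boundary_min_normal_derivative[where W = "\<lambda>x. G x - \<epsilon> *\<^sub>R \<phi>' x" and w = w, OF _ \<rho>(1) inward_normal])
    show "z \<in> closure \<Omega>" using z_A A_closure by auto
    show "continuous_on (closure \<Omega> \<inter> ball z \<rho>) w"
      using \<rho> by (intro continuous_on_subset[OF cont_w]) auto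
    show "continuous_on (closure \<Omega> \<inter> ball z \<rho>) (\<lambda>x. G x - \<epsilon> *\<^sub>R \<phi>' x)"
      using \<rho> by (intro continuous_intros continuous_on_subset[OF G(1)] continuous_on_subset[OF cont_\<phi>(2)]) auto
    show "(w has_derivative (\<lambda>v. (G x - \<epsilon> *\<^sub>R \<phi>' x) \<bullet> v)) (at x)" if "x \<in> \<Omega> \<inter> ball z \<rho>" for x
      using has_grad_lapD(1)[OF interior, of x] that \<rho> G(2)[of x] by auto
    show "w z \<le> w x" if "x \<in> \<Omega> \<inter> ball z \<rho>" for x
      using x0(2)[OF inside_A[OF that]] w_pos wz by simp
  qed
  moreover have "\<phi>' z \<bullet> outward_unit_normal \<Omega> z = - (a * norm (k z))"
    using grad_nonzero by (simp add: \<phi>'_def zero outward_unit_normal_eq dot_square_norm power2_eq_square)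
  ultimately have "G z \<bullet> outward_unit_normal \<Omega> z \<le> - (\<epsilon> * (a * norm (k z)))"
    by (simp add: inner_diff_left)
  also have "\<dots> < 0" using \<epsilon> a grad_nonzero by simp
  finally show ?thesis .
qed

end

text \<open>
  At a boundary zero the Robin condition would force the normal derivative to vanish, contrary to
  Hopf's lemma.  Hence the logarithm of an eigenfunction is continuous on the closure.
\<close>

lemma positive_eigenfunction_pos_closure:
  assumes \<Omega>: "open \<Omega>" "C2_holder_boundary \<alpha> \<Omega>"
    and u: "positive_eigenfunction \<beta> \<Omega> \<sigma> u" and x: "x \<in> closure \<Omega>"
  shows "0 < u x"
proof (cases "x \<in> \<Omega>")
  case True
  then show ?thesis using u by (simp add: positive_eigenfunction_def)
next
  case False
  then have fr: "x \<in> frontier \<Omega>" using x closure_Un_frontier by blast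
  then obtain r e h k l where "C2_defining_function \<Omega> x r e h k l"
    using C2_defining_function_exists[OF \<Omega>] by blast
  then interpret C2_defining_function \<Omega> x r e h k l .
  obtain G where G: "continuous_on (closure \<Omega>) G" "\<And>x. x \<in> \<Omega> \<Longrightarrow> G x = grad u x"
      "G x \<bullet> outward_unit_normal \<Omega> x + \<beta> x * u x = 0"
    using u fr by (auto simp: positive_eigenfunction_def)
  have "u x \<noteq> 0"
    using hopf_lemma[of u \<sigma> G] u G by (auto simp: positive_eigenfunction_def)
  moreover have "0 \<le> u x"
    using continuous_ge_on_closure[of \<Omega> u x 0] u x by (auto simp: positive_eigenfunction_def less_imp_le)
  ultimately show ?thesis by simp
qed

section \<open>Comparison with a test function\<close>

text \<open>
  The function \<open>w = s ln u - \<psi>\<close> has normal derivative \<open>- s \<beta> - \<partial>\<psi>/\<partial>n\<close> on the boundary, which is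
  positive as soon as \<open>|\<nabla>\<psi>| < - s \<beta>\<close>.  So the minimum of \<open>w\<close> on the closure is attained inside
  the domain.  There \<open>s \<nabla>u / u = \<nabla>\<psi>\<close>, and \<open>\<Delta>w \<ge> 0\<close> reads
  \<open>- s \<sigma> - s |\<nabla>\<psi>|\<^sup>2 - \<Delta>\<psi> \<ge> 0\<close>.  The sign \<open>s\<close> treats both signs of \<open>\<beta>\<close> at once.
\<close>

lemma eigenvalue_comparison:
  fixes \<Omega> :: "(real^'n::finite) set"
  assumes \<Omega>: "open \<Omega>" "bounded \<Omega>" "\<Omega> \<noteq> {}" "C2_holder_boundary \<alpha> \<Omega>"
    and u: "positive_eigenfunction \<beta> \<Omega> \<sigma> u"
    and \<psi>: "has_grad_lap \<psi> g l UNIV"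
    and s: "s = 1 \<or> s = (- 1 :: real)"
    and bdry: "\<And>x. x \<in> frontier \<Omega> \<Longrightarrow> norm (g x) < - s * \<beta> x"
    and lap: "\<And>x. x \<in> \<Omega> \<Longrightarrow> c \<le> l x"
    and grd: "\<And>x. x \<in> \<Omega> \<Longrightarrow> norm (g x) \<le> \<eta>"
  shows "c - \<eta>\<^sup>2 \<le> - s * \<sigma>"
proof -
  obtain G where G: "continuous_on (closure \<Omega>) G" "\<And>x. x \<in> \<Omega> \<Longrightarrow> G x = grad u x"
      "\<And>x. x \<in> frontier \<Omega> \<Longrightarrow> G x \<bullet> outward_unit_normal \<Omega> x + \<beta> x * u x = 0"
    using u by (auto simp: positive_eigenfunction_def)
  have u_pos: "0 < u x" if "x \<in> closure \<Omega>" for x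
    using positive_eigenfunction_pos_closure[OF \<Omega>(1,4) u that] .
  have C2u: "C2_on \<Omega> u" and cont_u: "continuous_on (closure \<Omega>) u"
    and eq: "\<And>x. x \<in> \<Omega> \<Longrightarrow> - laplacian u x = \<sigma> * u x"
    using u by (auto simp: positive_eigenfunction_def)
  define w where "w x = s * ln (u x) - \<psi> x" for x
  have w: "has_grad_lap w (\<lambda>x. s *\<^sub>R (inverse (u x) *\<^sub>R grad u x) - g x)
     (\<lambda>x. s * (inverse (u x) * laplacian u x + - (inverse (u x))\<^sup>2 * (grad u x \<bullet> grad u x)) - l x) \<Omega>"
    unfolding w_def[abs_def]
  proof (intro has_grad_lap_diff has_grad_lap_cmult has_grad_lap_subset[OF \<psi>] subset_UNIV
      has_grad_lap_compose[OF C2_on_has_grad_lap[OF C2u]])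
    fix x assume "x \<in> \<Omega>"
    then have "0 < u x" using u_pos closure_subset by blast
    then show "(ln has_real_derivative inverse (u x)) (at (u x))"
      and "(inverse has_real_derivative - (inverse (u x))\<^sup>2) (at (u x))"
      by (auto intro!: derivative_eq_intros simp: power2_eq_square divide_simps)
  qed
  have cont_\<psi>: "continuous_on (closure \<Omega>) \<psi>" "continuous_on (closure \<Omega>) g"
    using has_grad_lap_continuous_on[OF \<psi>] continuous_on_subset by blast+
  have cont_w: "continuous_on (closure \<Omega>) w"
    unfolding w_def[abs_def]
    by (intro continuous_intros cont_u cont_\<psi>) (use u_pos in force)
  have "compact (closure \<Omega>)" "closure \<Omega> \<noteq> {}" using \<Omega> by (auto simp: compact_closure)
  then obtain z where z: "z \<in> closure \<Omega>" "\<And>x. x \<in> closure \<Omega> \<Longrightarrow> w z \<le> w x"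
    using continuous_attains_inf[OF _ _ cont_w] by blast
  have z\<Omega>: "z \<in> \<Omega>"
  proof (rule ccontr)
    assume "z \<notin> \<Omega>"
    then have fr: "z \<in> frontier \<Omega>" using z closure_Un_frontier by blast
    then obtain r e h k l where "C2_defining_function \<Omega> z r e h k l"
      using C2_defining_function_exists[OF \<Omega>(1,4)] by blast
    then interpret C2_defining_function \<Omega> z r e h k l .
    let ?n = "outward_unit_normal \<Omega> z"
    have "(s *\<^sub>R (inverse (u z) *\<^sub>R G z) - g z) \<bullet> ?n \<le> 0"
    proof (rule boundary_min_normal_derivative[where w = w and \<rho> = r
          and W = "\<lambda>x. s *\<^sub>R (inverse (u x) *\<^sub>R G x) - g x", OF z(1) radius inward_normal])
      show "continuous_on (closure \<Omega> \<inter> ball z r) w"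
        by (intro continuous_on_subset[OF cont_w]) auto
      have "continuous_on (closure \<Omega>) (\<lambda>x. s *\<^sub>R (inverse (u x) *\<^sub>R G x) - g x)"
        by (intro continuous_intros cont_u cont_\<psi> G(1)) (use u_pos in force)
      then show "continuous_on (closure \<Omega> \<inter> ball z r) (\<lambda>x. s *\<^sub>R (inverse (u x) *\<^sub>R G x) - g x)"
        by (rule continuous_on_subset) auto
      show "(w has_derivative (\<lambda>v. (s *\<^sub>R (inverse (u x) *\<^sub>R G x) - g x) \<bullet> v)) (at x)"
        if "x \<in> \<Omega> \<inter> ball z r" for x
        using has_grad_lapD(1)[OF w, of x] that G(2)[of x] by auto
      show "w z \<le> w x" if "x \<in> \<Omega> \<inter> ball z r" for x
        using z(2)[of x] that closure_subset by blast
    qed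
    moreover have "(s *\<^sub>R (inverse (u z) *\<^sub>R G z) - g z) \<bullet> ?n = - s * \<beta> z - g z \<bullet> ?n"
    proof -
      have "G z \<bullet> ?n = - \<beta> z * u z" using G(3)[OF fr] by simp
      then show ?thesis using u_pos[OF z(1)] by (simp add: inner_diff_left)
    qed
    moreover have "g z \<bullet> ?n \<le> norm (g z)"
      using norm_cauchy_schwarz[of "g z" ?n] grad_nonzero by (simp add: outward_unit_normal_eq)
    ultimately show False using bdry[OF fr] by linarith
  qed
  have "\<forall>\<^sub>F y in nhds z. y \<in> \<Omega>" using z\<Omega> \<Omega>(1) by (intro eventually_nhds_in_open) auto
  then have loc: "\<forall>\<^sub>F y in nhds z. w z \<le> w y"
    by eventually_elim (use z(2) closure_subset in blast)
  note crit = has_grad_lap_local_min[OF w \<Omega>(1) z\<Omega> loc]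
  have uz: "0 < u z" using u_pos z(1) .
  define v where "v = inverse (u z) *\<^sub>R grad u z"
  have sv: "s *\<^sub>R v = g z" using crit(1) by (simp add: v_def)
  have "v \<bullet> v = (s *\<^sub>R v) \<bullet> (s *\<^sub>R v)" using s by auto
  then have vv: "v \<bullet> v = (norm (g z))\<^sup>2" by (simp add: sv power2_norm_eq_inner)
  have "inverse (u z) * laplacian u z = - \<sigma>" using eq[OF z\<Omega>] uz by (simp add: field_simps)
  moreover have "(inverse (u z))\<^sup>2 * (grad u z \<bullet> grad u z) = v \<bullet> v"
    by (simp add: v_def power2_eq_square)
  ultimately have "l z \<le> s * (- \<sigma> - (norm (g z))\<^sup>2)" using crit(2) vv by (simp add: minus_mult_left[symmetric])
  then have "l z + s * (norm (g z))\<^sup>2 \<le> - s * \<sigma>" by (simp add: algebra_simps)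
  moreover have "- (norm (g z))\<^sup>2 \<le> s * (norm (g z))\<^sup>2" using s by auto
  moreover have "(norm (g z))\<^sup>2 \<le> \<eta>\<^sup>2" using grd[OF z\<Omega>] by (intro power_mono) auto
  ultimately show ?thesis using lap[OF z\<Omega>] by linarith
qed

section \<open>A potential with small gradient on sets of small measure\<close>

definition unit_ball_volume :: "'n::finite itself \<Rightarrow> real" where
  "unit_ball_volume _ = measure lborel (ball (0 :: real^'n) 1)"

lemma unit_ball_volume_pos: "0 < unit_ball_volume TYPE('n::finite)"
  using content_ball_pos[of 1 "0 :: real^'n"] by (simp add: unit_ball_volume_def)

lemma content_ball_eq:
  "0 \<le> r \<Longrightarrow> measure lborel (ball (x :: real^'n::finite) r) = r ^ CARD('n) * unit_ball_volume TYPE('n)"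
  using content_ball_conv_unit_ball[of r x] by (simp add: unit_ball_volume_def)

text \<open>
  The balls of half the separation radius are disjoint.
\<close>

lemma separated_card_bound:
  fixes Y :: "(real^'n::finite) set"
  assumes Y: "finite Y" "pairwise (\<lambda>x y. h \<le> dist x y) Y" and h: "0 < h"
    and U: "U \<in> lmeasurable" "\<And>y. y \<in> Y \<Longrightarrow> ball y (h / 2) \<subseteq> U"
  shows "real (card Y) * ((h / 2) ^ CARD('n) * unit_ball_volume TYPE('n)) \<le> measure lebesgue U"
proof -
  have disj: "pairwise (\<lambda>x y. disjnt (ball x (h / 2)) (ball y (h / 2))) Y"
  proof (rule pairwise_mono[OF Y(2)])
    fix x y :: "real^'n" assume "h \<le> dist x y"
    then have "ball x (h / 2) \<inter> ball y (h / 2) = {}"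
      by (intro disjoint_ballI) simp
    then show "disjnt (ball x (h / 2)) (ball y (h / 2))" by (simp add: disjnt_def)
  qed auto
  have "measure lebesgue (\<Union>y\<in>Y. ball y (h / 2)) = (\<Sum>y\<in>Y. measure lebesgue (ball y (h / 2)))"
    using Y(1) disj by (intro measure_UNION') auto
  then have "real (card Y) * ((h / 2) ^ CARD('n) * unit_ball_volume TYPE('n)) =
      measure lebesgue (\<Union>y\<in>Y. ball y (h / 2))"
    using h by (simp add: content_ball_eq)
  also have "\<dots> \<le> measure lebesgue U"
    using U Y(1) by (intro measure_mono_fmeasurable) auto
  finally show ?thesis .
qed

lemma separated_card_in_ball:
  fixes Y :: "(real^'n::finite) set"
  assumes Y: "finite Y" "pairwise (\<lambda>x y. h \<le> dist x y) Y" and h: "0 < h" "h \<le> \<rho>"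
    and sub: "Y \<subseteq> ball x \<rho>"
  shows "real (card Y) * h ^ CARD('n) \<le> (3 * \<rho>) ^ CARD('n)"
proof -
  let ?N = "CARD('n)" and ?\<omega> = "unit_ball_volume TYPE('n)"
  have "ball y (h / 2) \<subseteq> ball x (3 * \<rho> / 2)" if "y \<in> Y" for y
  proof
    fix v assume "v \<in> ball y (h / 2)"
    then show "v \<in> ball x (3 * \<rho> / 2)"
      using dist_triangle[of x v y] subsetD[OF sub that] h by simp
  qed
  from separated_card_bound[OF Y h(1) _ this]
  have "(real (card Y) * (h / 2) ^ ?N) * ?\<omega> \<le> (3 * \<rho> / 2) ^ ?N * ?\<omega>"
    using h by (simp add: content_ball_eq mult.assoc)
  then have "real (card Y) * (h / 2) ^ ?N \<le> (3 * \<rho> / 2) ^ ?N"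
    using unit_ball_volume_pos[where 'n = 'n] by (simp only: mult_le_cancel_right_pos)
  then have "real (card Y) * h ^ ?N / 2 ^ ?N \<le> (3 * \<rho>) ^ ?N / 2 ^ ?N"
    by (simp add: power_divide)
  then show ?thesis by (simp add: divide_le_cancel)
qed

text \<open>
  The volume bound limits the cardinality of separated subsets, so there is a separated subset of
  largest cardinality; a point far from all its members could be added to it.
\<close>

lemma maximal_separated_set:
  fixes K :: "(real^'n::finite) set"
  assumes K: "bounded K" and h: "0 < h"
  obtains Y where "finite Y" "Y \<subseteq> K" "pairwise (\<lambda>x y. h \<le> dist x y) Y"
    "\<And>x. x \<in> K \<Longrightarrow> \<exists>y\<in>Y. dist x y < h"
proof -
  let ?S = "\<lambda>Y. finite Y \<and> Y \<subseteq> K \<and> pairwise (\<lambda>x y. h \<le> dist x y) Y"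
  obtain R where R: "0 < R" "K \<subseteq> ball 0 R"
    using bounded_subset_ballD[OF K, of 0] by blast
  obtain B :: nat where B: "(3 * max R h) ^ CARD('n) / h ^ CARD('n) < real B"
    using reals_Archimedean2 by blast
  have "card Y < B" if "?S Y" for Y
  proof -
    have "Y \<subseteq> ball 0 (max R h)" using that R by fastforce
    then have "real (card Y) * h ^ CARD('n) \<le> (3 * max R h) ^ CARD('n)"
      using that h by (intro separated_card_in_ball[where x = 0]) auto
    then have "real (card Y) \<le> (3 * max R h) ^ CARD('n) / h ^ CARD('n)"
      using h by (simp add: pos_le_divide_eq)
    then show ?thesis using B by linarith
  qed
  then have "\<exists>Y. ?S Y \<and> (\<forall>Z. ?S Z \<longrightarrow> card Z \<le> card Y)"
    by (intro ex_has_greatest_nat[of ?S "{}" card B]) (auto simp: less_imp_le)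
  then obtain Y where Y: "?S Y" and max: "\<And>Z. ?S Z \<Longrightarrow> card Z \<le> card Y" by blast
  show ?thesis
  proof (rule that)
    fix x assume x: "x \<in> K"
    show "\<exists>y\<in>Y. dist x y < h"
    proof (rule ccontr)
      assume "\<not> (\<exists>y\<in>Y. dist x y < h)"
      then have far: "\<And>y. y \<in> Y \<Longrightarrow> h \<le> dist x y" by force
      then have "x \<notin> Y" using h by force
      moreover have "?S (insert x Y)"
        using Y x far by (auto simp: pairwise_insert dist_commute)
      ultimately show False using max[of "insert x Y"] Y by simp
    qed
  qed (use Y in auto)
qed

text \<open>
  A discrete form of \<open>\<integral> |x - y|\<^bsup>1-N\<^esup> dy \<le> C \<rho>\<close> over a ball of radius \<open>\<rho>\<close>, where each point of \<open>Y\<close> carries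
  the mass \<open>h\<^bsup>N\<^esup>\<close>.  Each doubling of the radius adds an annulus that contains at most
  \<open>(3 \<rho> / h)\<^bsup>N\<^esup>\<close> points, \<open>\<rho>\<close> being the outer radius, hence contributes at most a constant times the
  old radius; these contributions form a geometric series.
\<close>

lemma near_sum_bound:
  fixes Y :: "(real^'n::finite) set"
  assumes Y: "finite Y" "pairwise (\<lambda>x y. h \<le> dist x y) Y" and h: "0 < h"
  shows "(\<Sum>y\<in>Y \<inter> ball x (2 ^ m * h). h ^ CARD('n) / max (dist x y) h ^ (CARD('n) - 1)) \<le> 6 ^ CARD('n) * (2 ^ m * h)"
    (is "sum ?q _ \<le> _")
proof -
  have N: "h ^ CARD('n) = h * h ^ (CARD('n) - 1)" for h :: real
    using power_minus_mult[of "CARD('n)" h] by (simp add: mult.commute)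
  have count: "real (card (Y \<inter> ball x (2 ^ m * h))) \<le> (3 * 2 ^ m) ^ CARD('n)" for m
  proof -
    have "h \<le> 2 ^ m * h" using h by simp
    then have "real (card (Y \<inter> ball x (2 ^ m * h))) * h ^ CARD('n) \<le> (3 * (2 ^ m * h)) ^ CARD('n)"
      using Y h by (intro separated_card_in_ball) (auto intro: pairwise_subset)
    then have "real (card (Y \<inter> ball x (2 ^ m * h))) * h ^ CARD('n) \<le> (3 * 2 ^ m) ^ CARD('n) * h ^ CARD('n)"
      by (simp add: power_mult_distrib mult.assoc)
    then show ?thesis using h by (simp only: mult_le_cancel_right_pos zero_less_power)
  qed
  show ?thesis
  proof (induction m)
    case 0
    have "sum ?q (Y \<inter> ball x (2 ^ 0 * h)) \<le> (\<Sum>y\<in>Y \<inter> ball x (2 ^ 0 * h). h)"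
      using h by (intro sum_mono) (auto simp: max_absorb2 N)
    also have "\<dots> = real (card (Y \<inter> ball x (2 ^ 0 * h))) * h" by simp
    also have "\<dots> \<le> 3 ^ CARD('n) * h" using count[of 0] h by (intro mult_right_mono) auto
    also have "\<dots> \<le> 6 ^ CARD('n) * (2 ^ 0 * h)" using h by (auto intro!: mult_right_mono power_mono)
    finally show ?case .
  next
    case (Suc m)
    let ?A = "Y \<inter> ball x (2 ^ Suc m * h) - ball x (2 ^ m * h)"
    have sub: "Y \<inter> ball x (2 ^ m * h) \<subseteq> Y \<inter> ball x (2 ^ Suc m * h)"
    proof -
      have "2 ^ m * h \<le> 2 ^ Suc m * h" using h by simp
      then show ?thesis using subset_ball by blast
    qed
    have "sum ?q ?A \<le> (\<Sum>y\<in>?A. h ^ CARD('n) / (2 ^ m * h) ^ (CARD('n) - 1))"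
      using h by (intro sum_mono divide_left_mono power_mono mult_pos_pos) auto
    also have "\<dots> = real (card ?A) * (h ^ CARD('n) / (2 ^ m * h) ^ (CARD('n) - 1))" by simp
    also have "\<dots> \<le> (3 * 2 ^ Suc m) ^ CARD('n) * (h ^ CARD('n) / (2 ^ m * h) ^ (CARD('n) - 1))"
    proof (intro mult_right_mono)
      have "card ?A \<le> card (Y \<inter> ball x (2 ^ Suc m * h))" using Y(1) by (intro card_mono) auto
      then show "real (card ?A) \<le> (3 * 2 ^ Suc m) ^ CARD('n)" using count[of "Suc m"] by linarith
    qed (use h in auto)
    also have "\<dots> = (6 * 2 ^ m) ^ CARD('n) * (h / (2 ^ m) ^ (CARD('n) - 1))"
      using h by (simp add: N[of h] power_mult_distrib)
    also have "\<dots> = 6 ^ CARD('n) * (2 ^ m * h)"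
      by (simp add: N[of "2 ^ m"] power_mult_distrib)
    finally have new: "sum ?q ?A \<le> 6 ^ CARD('n) * (2 ^ m * h)" .
    have "sum ?q (Y \<inter> ball x (2 ^ Suc m * h)) = sum ?q ?A + sum ?q (Y \<inter> ball x (2 ^ m * h))"
      using sum.subset_diff[OF sub, of ?q] Y(1) by (simp add: Diff_Int Int_Diff)
    also have "\<dots> \<le> 6 ^ CARD('n) * (2 ^ m * h) + 6 ^ CARD('n) * (2 ^ m * h)"
      using new Suc by linarith
    finally show ?case by (simp add: mult_ac)
  qed
qed

text \<open>
  Split at a dyadic radius between \<open>r\<close> and \<open>2 r\<close>: the near points are handled by the previous
  lemma, and a far point contributes at most \<open>h\<^bsup>N\<^esup> / r\<^bsup>N-1\<^esup>\<close>.
\<close>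

lemma total_sum_bound:
  fixes Y :: "(real^'n::finite) set"
  assumes Y: "finite Y" "pairwise (\<lambda>x y. h \<le> dist x y) Y" and h: "0 < h" "h \<le> r"
  shows "(\<Sum>y\<in>Y. h ^ CARD('n) / max (dist x y) h ^ (CARD('n) - 1))
    \<le> 2 * 6 ^ CARD('n) * r + real (card Y) * h ^ CARD('n) / r ^ (CARD('n) - 1)"
    (is "sum ?q _ \<le> _")
proof -
  have "\<exists>m::nat. r \<le> 2 ^ m * h"
  proof -
    obtain m :: nat where "r / h < 2 ^ m" using real_arch_pow[of 2 "r / h"] by auto
    then show ?thesis using h by (auto simp: field_simps intro!: exI[of _ m])
  qed
  then obtain m :: nat where m: "r \<le> 2 ^ m * h" and least: "\<And>i. i < m \<Longrightarrow> \<not> r \<le> 2 ^ i * h"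
    using exists_least_iff[of "\<lambda>m::nat. r \<le> 2 ^ m * h"] by blast
  have upper: "2 ^ m * h \<le> 2 * r"
  proof (cases m)
    case 0
    then show ?thesis using h by simp
  next
    case (Suc i)
    then show ?thesis using least[of i] by simp
  qed
  let ?A = "Y - ball x (2 ^ m * h)"
  have "sum ?q ?A \<le> (\<Sum>y\<in>?A. h ^ CARD('n) / r ^ (CARD('n) - 1))"
  proof (intro sum_mono)
    fix y assume "y \<in> ?A"
    then have "r \<le> max (dist x y) h" using m by (simp add: max_def not_less)
    then show "?q y \<le> h ^ CARD('n) / r ^ (CARD('n) - 1)"
      using h by (intro divide_left_mono power_mono mult_pos_pos zero_less_power) auto
  qed
  also have "\<dots> = real (card ?A) * (h ^ CARD('n) / r ^ (CARD('n) - 1))" by simp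
  also have "\<dots> \<le> real (card Y) * (h ^ CARD('n) / r ^ (CARD('n) - 1))"
    using h Y(1) by (intro mult_right_mono) (auto intro: card_mono)
  finally have far: "sum ?q ?A \<le> real (card Y) * h ^ CARD('n) / r ^ (CARD('n) - 1)" by simp
  have near: "sum ?q (Y \<inter> ball x (2 ^ m * h)) \<le> 6 ^ CARD('n) * (2 * r)"
    by (rule order_trans[OF near_sum_bound[OF Y h(1)] mult_left_mono[OF upper]]) simp
  have "sum ?q Y = sum ?q (Y - Y \<inter> ball x (2 ^ m * h)) + sum ?q (Y \<inter> ball x (2 ^ m * h))"
    by (rule sum.subset_diff) (use Y in auto)
  also have "Y - Y \<inter> ball x (2 ^ m * h) = ?A" by auto
  finally show ?thesis using near far by (simp add: mult.assoc mult.left_commute)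
qed

lemma power_antiderivative:
  fixes p :: real
  obtains F where "\<And>s. 0 < s \<Longrightarrow> (F has_real_derivative s powr p) (at s)"
proof (cases "p = -1")
  case True
  show ?thesis
    by (rule that[of ln]) (auto intro!: derivative_eq_intros simp: True powr_minus_divide)
next
  case False
  show ?thesis
  proof (rule that[of "\<lambda>s. s powr (p + 1) / (p + 1)"])
    fix s :: real assume "0 < s"
    then show "((\<lambda>s. s powr (p + 1) / (p + 1)) has_real_derivative s powr p) (at s)"
      using False by (auto intro!: derivative_eq_intros)
  qed
qed

text \<open>
  With \<open>s = |x - y|\<^sup>2 + h\<^sup>2\<close>, the potential is \<open>F s / 2\<close> where \<open>F\<close> is an antiderivative of \<open>s\<^bsup>-N/2\<^esup>\<close>.
  For \<open>h = 0\<close> it would be the Newton potential, up to a factor, whose Laplacian vanishes away from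
  \<open>y\<close>; the regularisation spreads the point mass over the scale \<open>h\<close> and keeps the Laplacian
  positive everywhere.
\<close>

lemma regularized_newton_potential:
  fixes y :: "real^'n::finite"
  assumes h: "0 < h"
  obtains \<psi> where "has_grad_lap \<psi>
     (\<lambda>x. ((x - y) \<bullet> (x - y) + h\<^sup>2) powr (- real CARD('n) / 2) *\<^sub>R (x - y))
     (\<lambda>x. real CARD('n) * h\<^sup>2 * ((x - y) \<bullet> (x - y) + h\<^sup>2) powr (- real CARD('n) / 2 - 1)) UNIV"
proof -
  define N where "N = real CARD('n)"
  define q where "q x = (x - y) \<bullet> (x - y) + h\<^sup>2" for x
  obtain F where F: "\<And>s. 0 < s \<Longrightarrow> (F has_real_derivative s powr (- N / 2)) (at s)"
    using power_antiderivative by blast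
  have q_pos: "0 < q x" for x using h by (simp add: q_def add_nonneg_pos)
  have q: "has_grad_lap q (\<lambda>x. 2 *\<^sub>R (x - y)) (\<lambda>x. 2 * N) UNIV"
    using has_grad_lap_add[OF has_grad_lap_sqdist[of y UNIV] has_grad_lap_const[of "h\<^sup>2"]]
    by (simp add: q_def[abs_def] N_def)
  have "has_grad_lap (\<lambda>x. F (q x) / 2) (\<lambda>x. (q x powr (- N / 2) / 2) *\<^sub>R (2 *\<^sub>R (x - y)))
      (\<lambda>x. (q x powr (- N / 2) / 2) * (2 * N) +
           (- N / 2 * q x powr (- N / 2 - 1) / 2) * (2 *\<^sub>R (x - y) \<bullet> 2 *\<^sub>R (x - y))) UNIV"
    by (rule has_grad_lap_compose[OF q, where F = "\<lambda>s. F s / 2"])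
       (use q_pos in \<open>auto intro!: derivative_eq_intros F\<close>)
  moreover have "(q x powr (- N / 2) / 2) *\<^sub>R (2 *\<^sub>R (x - y)) = q x powr (- N / 2) *\<^sub>R (x - y)" for x
    by simp
  moreover have "(q x powr (- N / 2) / 2) * (2 * N) +
           (- N / 2 * q x powr (- N / 2 - 1) / 2) * (2 *\<^sub>R (x - y) \<bullet> 2 *\<^sub>R (x - y))
      = N * h\<^sup>2 * q x powr (- N / 2 - 1)" for x
  proof -
    have "q x powr (- N / 2) = q x powr (- N / 2 - 1 + 1)" by simp
    also have "\<dots> = q x powr (- N / 2 - 1) * q x" using q_pos[of x] by (simp only: powr_add powr_one)
    finally have 1: "q x powr (- N / 2) = q x powr (- N / 2 - 1) * q x" .
    have 2: "(x - y) \<bullet> (x - y) = q x - h\<^sup>2" by (simp add: q_def)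
    show ?thesis unfolding 1 inner_scaleR_left inner_scaleR_right 2 by (simp add: field_simps)
  qed
  ultimately have "has_grad_lap (\<lambda>x. F (q x) / 2) (\<lambda>x. q x powr (- N / 2) *\<^sub>R (x - y))
      (\<lambda>x. N * h\<^sup>2 * q x powr (- N / 2 - 1)) UNIV"
    by simp
  then show ?thesis unfolding q_def N_def by (rule that)
qed

text \<open>
  A lower bound for the Laplacian of one regularised potential of mass \<open>h\<^bsup>N\<^esup>\<close> at distance at most
  \<open>h\<close> from its centre.  It is independent of \<open>h\<close>.
\<close>

definition lap_bound :: "'n::finite itself \<Rightarrow> real" where
  "lap_bound _ = real CARD('n) * 2 powr (- real CARD('n) / 2 - 1)"

lemma lap_bound_pos: "0 < lap_bound TYPE('n::finite)"
  by (simp add: lap_bound_def)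

text \<open>
  The function \<open>\<psi>\<close> is a Riemann sum for the Newton potential of \<open>K\<close>: one regularised potential
  of mass \<open>h\<^bsup>N\<^esup>\<close> at each point of a maximal \<open>h\<close>-separated subset \<open>Y\<close> of \<open>K\<close>.  Each point of \<open>K\<close> is
  within \<open>h\<close> of some member of \<open>Y\<close>, whose potential alone bounds the Laplacian from below.
  If \<open>h\<close> is so small that the \<open>h\<close>-neighbourhood of \<open>K\<close> still has measure at most \<open>\<delta>\<close>, the total
  mass is at most a constant times \<open>\<delta>\<close>, and the gradient at any point is bounded by a constant
  times \<open>r + \<delta> / r\<^bsup>N-1\<^esup>\<close>.
\<close>

theorem small_gradient_potential:
  fixes \<eta> :: real
  assumes \<eta>: "0 < \<eta>"
  obtains \<delta> where "0 < \<delta>"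
    "\<And>K :: (real^'n::finite) set. compact K \<Longrightarrow> measure lebesgue K < \<delta> \<Longrightarrow>
       \<exists>\<psi> g l. has_grad_lap \<psi> g l UNIV \<and> (\<forall>x. norm (g x) \<le> \<eta>) \<and> (\<forall>x\<in>K. lap_bound TYPE('n) \<le> l x)"
proof -
  let ?N = "CARD('n)" and ?\<omega> = "unit_ball_volume TYPE('n)"
  \<comment> \<open>\<open>r\<close> makes the near part of the gradient at most \<open>\<eta> / 2\<close>, and \<open>\<delta>\<close> then does the same for the far part.\<close>
  define r where "r = \<eta> / (4 * 6 ^ ?N)"
  have r: "0 < r" using \<eta> by (simp add: r_def)
  define \<delta> where "\<delta> = \<eta> / 2 * ?\<omega> * r ^ (?N - 1) / 2 ^ ?N"
  have \<delta>: "0 < \<delta>" using \<eta> r unit_ball_volume_pos[where 'n = 'n] by (simp add: \<delta>_def)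
  show ?thesis
  proof (rule that[OF \<delta>])
    fix K :: "(real^'n) set" assume K: "compact K" and small: "measure lebesgue K < \<delta>"
    have K_meas: "K \<in> lmeasurable" using K by (rule lmeasurable_compact)
    obtain U where U: "open U" "K \<subseteq> U" "U - K \<in> lmeasurable" "emeasure lebesgue (U - K) < ennreal (\<delta> - measure lebesgue K)"
      using sets_lebesgue_outer_open[of K "\<delta> - measure lebesgue K"] K_meas small by auto
    have U_meas: "U \<in> lmeasurable"
      using fmeasurable.Un[OF K_meas U(3)] U(2) by (simp add: Un_absorb1)
    have "measure lebesgue (U - K) < \<delta> - measure lebesgue K"
      using U(4) small emeasure_eq_measure2[OF U(3)] by (simp add: ennreal_less_iff)
    moreover have "measure lebesgue U \<le> measure lebesgue K + measure lebesgue (U - K)"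
      using measure_Un_le[of K lebesgue "U - K"] K_meas U(2,3) by (simp add: Un_absorb1 fmeasurableD)
    ultimately have U_small: "measure lebesgue U \<le> \<delta>" by simp
    obtain \<epsilon> where \<epsilon>: "0 < \<epsilon>" "(\<Union>x\<in>K. ball x \<epsilon>) \<subseteq> U"
      using compact_subset_open_imp_ball_epsilon_subset[OF K U(1,2)] by blast
    define h where "h = min r \<epsilon>"
    have h: "0 < h" "h \<le> r" "h \<le> \<epsilon>" using r \<epsilon> by (auto simp: h_def)
    obtain Y where Y: "finite Y" "Y \<subseteq> K" "pairwise (\<lambda>x y. h \<le> dist x y) Y"
      and cover: "\<And>x. x \<in> K \<Longrightarrow> \<exists>y\<in>Y. dist x y < h"
      using maximal_separated_set[OF compact_imp_bounded[OF K] h(1)] by blast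
    have "ball y (h / 2) \<subseteq> U" if "y \<in> Y" for y
      using \<epsilon>(2) subsetD[OF Y(2) that] subset_ball[of "h / 2" \<epsilon> y] h by fastforce
    from separated_card_bound[OF Y(1,3) h(1) U_meas this]
    have "real (card Y) * ((h / 2) ^ ?N * ?\<omega>) \<le> \<delta>" using U_small by linarith
    then have "(real (card Y) * h ^ ?N) * (?\<omega> / 2 ^ ?N) \<le> (\<eta> / 2 * r ^ (?N - 1)) * (?\<omega> / 2 ^ ?N)"
      by (simp add: \<delta>_def power_divide mult_ac)
    then have card: "real (card Y) * h ^ ?N \<le> \<eta> / 2 * r ^ (?N - 1)"
      by (rule mult_right_le_imp_le) (use unit_ball_volume_pos[where 'n = 'n] in simp)
    define q where "q y x = (x - y) \<bullet> (x - y) + h\<^sup>2" for x y :: "real^'n"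
    have q_pos: "0 < q y x" for x y using h by (simp add: q_def add_nonneg_pos)
    have "\<exists>\<psi>. has_grad_lap \<psi> (\<lambda>x. q y x powr (- real ?N / 2) *\<^sub>R (x - y))
       (\<lambda>x. real ?N * h\<^sup>2 * q y x powr (- real ?N / 2 - 1)) UNIV"
      for y
      unfolding q_def by (rule regularized_newton_potential[OF h(1), of y]) (rule exI)
    then obtain \<Phi> where \<Phi>: "has_grad_lap (\<Phi> y) (\<lambda>x. q y x powr (- real ?N / 2) *\<^sub>R (x - y))
       (\<lambda>x. real ?N * h\<^sup>2 * q y x powr (- real ?N / 2 - 1)) UNIV" for y
      by (rule that[OF someI_ex])
    define g where "g x = (\<Sum>y\<in>Y. h ^ ?N *\<^sub>R (q y x powr (- real ?N / 2) *\<^sub>R (x - y)))" for x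
    define l where "l x = (\<Sum>y\<in>Y. h ^ ?N * (real ?N * h\<^sup>2 * q y x powr (- real ?N / 2 - 1)))" for x
    have "has_grad_lap (\<lambda>x. \<Sum>y\<in>Y. h ^ ?N * \<Phi> y x) g l UNIV"
      unfolding g_def[abs_def] l_def[abs_def]
      by (intro has_grad_lap_sum Y has_grad_lap_cmult \<Phi>)
    moreover have "norm (g x) \<le> \<eta>" for x
    proof -
      have "norm (g x) \<le> (\<Sum>y\<in>Y. h ^ ?N / max (dist x y) h ^ (?N - 1))"
        unfolding g_def
      proof (rule sum_norm_le)
        fix y
        define d where "d = max (dist x y) h"
        have d: "0 < d" "h \<le> d" "norm (x - y) \<le> d" using h by (auto simp: d_def dist_norm)
        have "d powr 2 \<le> q y x"
          using h unfolding d_def q_def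
          by (cases "dist x y \<le> h") (auto simp: max_def dist_norm powr_numeral power2_norm_eq_inner)
        then have "q y x powr (- real ?N / 2) \<le> (d powr 2) powr (- real ?N / 2)"
          using d by (intro powr_mono2') auto
        also have "\<dots> = 1 / d ^ ?N"
          using d unfolding powr_powr by (simp add: powr_minus_divide powr_realpow)
        finally have "q y x powr (- real ?N / 2) * norm (x - y) \<le> 1 / d ^ ?N * d"
          using d by (intro mult_mono) auto
        then have "h ^ ?N * (q y x powr (- real ?N / 2) * norm (x - y)) \<le> h ^ ?N * (1 / d ^ ?N * d)"
          using h by (intro mult_left_mono) auto
        then have "norm (h ^ ?N *\<^sub>R (q y x powr (- real ?N / 2) *\<^sub>R (x - y))) \<le> h ^ ?N * (1 / d ^ ?N * d)"
          using h by (simp add: mult.assoc)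
        also have "\<dots> = h ^ ?N / d ^ (?N - 1)"
          using d power_minus_mult[of ?N d] by (simp add: field_simps)
        finally show "norm (h ^ ?N *\<^sub>R (q y x powr (- real ?N / 2) *\<^sub>R (x - y))) \<le> h ^ ?N / max (dist x y) h ^ (?N - 1)"
          by (simp add: d_def)
      qed
      also have "\<dots> \<le> 2 * 6 ^ ?N * r + real (card Y) * h ^ ?N / r ^ (?N - 1)"
        by (rule total_sum_bound[OF Y(1,3) h(1,2)])
      also have "\<dots> \<le> \<eta> / 2 + \<eta> / 2"
      proof (rule add_mono)
        show "2 * 6 ^ ?N * r \<le> \<eta> / 2" by (simp add: r_def)
        show "real (card Y) * h ^ ?N / r ^ (?N - 1) \<le> \<eta> / 2"
          using card r by (simp add: pos_divide_le_eq)
      qed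
      finally show ?thesis by simp
    qed
    moreover have "lap_bound TYPE('n) \<le> l x" if x: "x \<in> K" for x
    proof -
      obtain y where y: "y \<in> Y" "dist x y < h" using cover[OF x] by blast
      have "(norm (x - y))\<^sup>2 \<le> h\<^sup>2" using y by (intro power_mono) (auto simp: dist_norm)
      then have "q y x \<le> 2 * h powr 2" using h by (simp add: q_def power2_norm_eq_inner powr_numeral)
      then have *: "(2 * h powr 2) powr (- real ?N / 2 - 1) \<le> q y x powr (- real ?N / 2 - 1)"
        using q_pos[of y x] by (intro powr_mono2') auto
      have "h ^ ?N * h\<^sup>2 * (h powr 2) powr (- real ?N / 2 - 1) = 1"
      proof -
        have "h ^ ?N * h\<^sup>2 * (h powr 2) powr (- real ?N / 2 - 1) =
            h powr real ?N * h powr 2 * h powr (2 * (- real ?N / 2 - 1))"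
          using h unfolding powr_powr by (simp add: powr_realpow powr_numeral)
        also have "\<dots> = h powr 0" by (simp add: powr_add[symmetric])
        finally show ?thesis using h by simp
      qed
      then have "lap_bound TYPE('n) = real ?N * 2 powr (- real ?N / 2 - 1) * (h ^ ?N * h\<^sup>2 * (h powr 2) powr (- real ?N / 2 - 1))"
        by (simp add: lap_bound_def)
      also have "\<dots> = h ^ ?N * (real ?N * h\<^sup>2 * (2 * h powr 2) powr (- real ?N / 2 - 1))"
        by (simp add: powr_mult mult_ac)
      also have "\<dots> \<le> h ^ ?N * (real ?N * h\<^sup>2 * q y x powr (- real ?N / 2 - 1))"
        using * h by (intro mult_left_mono) auto
      also have "\<dots> \<le> l x"
        unfolding l_def using Y(1) y(1) h by (intro member_le_sum) auto
      finally show ?thesis .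
    qed
    ultimately show "\<exists>\<psi> g l. has_grad_lap \<psi> g l UNIV \<and> (\<forall>x. norm (g x) \<le> \<eta>) \<and> (\<forall>x\<in>K. lap_bound TYPE('n) \<le> l x)"
      by blast
  qed
qed

section \<open>Domains of small measure\<close>

context C2_defining_function
begin

text \<open>
  The boundary is locally the image of a subset of the hyperplane orthogonal to \<open>e\<close> under the
  differentiable map that shifts a point along \<open>e\<close> to the zero set of \<open>h\<close>.
\<close>

lemma negligible_boundary_part: "negligible (frontier \<Omega> \<inter> ball z r)"
proof -
  define f where "f y = y - h y *\<^sub>R e" for y
  define S where "S = (\<lambda>x. x - (x \<bullet> e) *\<^sub>R e) ` (frontier \<Omega> \<inter> ball z r)"
  have ee: "e \<bullet> e = 1" using unit by (simp add: dot_square_norm)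
  have "e \<noteq> 0" using unit by auto
  then have "negligible {y. e \<bullet> y = 0}" by (intro negligible_hyperplane) simp
  moreover have "S \<subseteq> {y. e \<bullet> y = 0}"
    by (auto simp: S_def inner_diff_right ee inner_commute)
  ultimately have "negligible S" by (rule negligible_subset)
  moreover have "f differentiable_on S"
    unfolding differentiable_on_def
  proof
    fix y assume "y \<in> S"
    then obtain x where x: "x \<in> ball z r" "y = x - (x \<bullet> e) *\<^sub>R e" by (auto simp: S_def)
    \<comment> \<open>The point \<open>y\<close> may lie outside the ball, but \<open>h\<close> near \<open>y\<close> is a translate of \<open>h\<close> near \<open>x\<close>.\<close>
    have "h = (\<lambda>v. h (v + (x \<bullet> e) *\<^sub>R e) - x \<bullet> e)" by (simp add: shift)
    moreover have "(\<lambda>v. h (v + (x \<bullet> e) *\<^sub>R e) - x \<bullet> e) differentiable (at y)"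
    proof -
      have "(h has_derivative (\<lambda>v. k x \<bullet> v)) (at (y + (x \<bullet> e) *\<^sub>R e))"
        using has_grad_lapD(1)[OF grad_lap x(1)] x(2) by simp
      moreover have "((\<lambda>v. v + (x \<bullet> e) *\<^sub>R e) has_derivative (\<lambda>v. v)) (at y)"
        by (auto intro!: derivative_eq_intros)
      ultimately have "((\<lambda>v. h (v + (x \<bullet> e) *\<^sub>R e)) has_derivative (\<lambda>v. k x \<bullet> v)) (at y)"
        using has_derivative_compose by blast
      then show ?thesis by (intro differentiable_diff) (auto simp: differentiable_def)
    qed
    ultimately have "h differentiable (at y)" by simp
    then have "f differentiable (at y)"
      unfolding f_def[abs_def] by (intro differentiable_diff differentiable_scaleR) auto
    then show "f differentiable (at y within S)" by (rule differentiable_at_withinI)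
  qed
  ultimately have "negligible (f ` S)"
    by (intro negligible_differentiable_image_negligible) auto
  moreover have "frontier \<Omega> \<inter> ball z r \<subseteq> f ` S"
  proof
    fix x assume x: "x \<in> frontier \<Omega> \<inter> ball z r"
    have "h (x + (- (x \<bullet> e)) *\<^sub>R e) = - (x \<bullet> e)" 
      unfolding shift using x frontier_iff[of x] by simp
    then have "f (x - (x \<bullet> e) *\<^sub>R e) = x" by (simp add: f_def)
    then show "x \<in> f ` S" using x by (force simp: S_def)
  qed
  ultimately show ?thesis by (rule negligible_subset)
qed

end

lemma negligible_frontier_C2_holder:
  fixes \<Omega> :: "(real^'n::finite) set"
  assumes "open \<Omega>" "C2_holder_boundary \<alpha> \<Omega>"
  shows "negligible (frontier \<Omega>)"
proof (subst locally_negligible_alt, rule ballI)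
  fix z assume z: "z \<in> frontier \<Omega>"
  then obtain r e h k l where "C2_defining_function \<Omega> z r e h k l"
    using C2_defining_function_exists[OF assms] by blast
  then interpret C2_defining_function \<Omega> z r e h k l .
  show "\<exists>U. openin (top_of_set (frontier \<Omega>)) U \<and> z \<in> U \<and> negligible U"
    using negligible_boundary_part z radius
    by (intro exI[of _ "frontier \<Omega> \<inter> ball z r"]) (auto intro: openin_open_Int)
qed

lemma measure_closure_C2_holder:
  fixes \<Omega> :: "(real^'n::finite) set"
  assumes "open \<Omega>" "bounded \<Omega>" "C2_holder_boundary \<alpha> \<Omega>"
  shows "measure lebesgue (closure \<Omega>) = measure lebesgue \<Omega>"
proof (rule measure_negligible_symdiff)
  show "\<Omega> \<in> lmeasurable" using assms by (simp add: lmeasurable_open)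
  show "negligible (\<Omega> - closure \<Omega> \<union> (closure \<Omega> - \<Omega>))"
    using negligible_frontier_C2_holder[OF assms(1,3)] closure_subset[of \<Omega>]
    by (auto simp: closure_Un_frontier elim!: negligible_subset)
qed

text \<open>
  Apply the comparison to \<open>T \<psi>\<close>, where \<open>T\<close> is chosen so large that \<open>T \<Delta>\<psi>\<close> exceeds the required bound, and
  then the measure so small that \<open>T |\<nabla>\<psi>| \<le> b / 2\<close> still respects the boundary condition.
\<close>

lemma principal_eigenvalue_signed_bound:
  fixes D :: "(real^'n::finite) set" and \<beta> :: "real^'n \<Rightarrow> real"
  assumes s: "s = 1 \<or> s = (- 1 :: real)" and b: "0 < b" and \<beta>: "\<And>x. x \<in> D \<Longrightarrow> b \<le> - s * \<beta> x"
  shows "\<exists>\<delta>>0. \<forall>\<Omega> \<sigma>. admissible_domain D \<Omega> \<and> is_principal_eigenvalue \<beta> \<Omega> \<sigma> \<and>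
              measure lebesgue \<Omega> < \<delta> \<longrightarrow> K < - s * \<sigma>"
proof -
  let ?c = "lap_bound TYPE('n)"
  define T where "T = (\<bar>K\<bar> + b\<^sup>2 + 1) / ?c"
  have Tc: "T * ?c = \<bar>K\<bar> + b\<^sup>2 + 1" and T: "0 < T"
    using lap_bound_pos[where 'n = 'n] by (auto simp: T_def intro!: divide_pos_pos add_nonneg_pos)
  have "0 < b / (2 * T)" using b T by simp
  then obtain \<delta> where \<delta>: "0 < \<delta>" "\<And>K :: (real^'n) set. compact K \<Longrightarrow> measure lebesgue K < \<delta> \<Longrightarrow>
       \<exists>\<psi> g l. has_grad_lap \<psi> g l UNIV \<and> (\<forall>x. norm (g x) \<le> b / (2 * T)) \<and> (\<forall>x\<in>K. ?c \<le> l x)"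
    using small_gradient_potential[where 'n = 'n] by metis
  show ?thesis
  proof (intro exI[of _ \<delta>] conjI \<delta>(1) allI impI)
    fix \<Omega> \<sigma>
    assume *: "admissible_domain D \<Omega> \<and> is_principal_eigenvalue \<beta> \<Omega> \<sigma> \<and> measure lebesgue \<Omega> < \<delta>"
    then obtain \<alpha> u where \<Omega>: "open \<Omega>" "bounded \<Omega>" "\<Omega> \<noteq> {}" "C2_holder_boundary \<alpha> \<Omega>" "closure \<Omega> \<subseteq> D"
      and u: "positive_eigenfunction \<beta> \<Omega> \<sigma> u"
      by (auto simp: admissible_domain_def is_principal_eigenvalue_def)
    have "compact (closure \<Omega>)" "measure lebesgue (closure \<Omega>) < \<delta>"
      using \<Omega> * measure_closure_C2_holder[of \<Omega> \<alpha>] by (auto simp: compact_closure)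
    then obtain \<psi> g l where \<psi>: "has_grad_lap \<psi> g l UNIV" "\<And>x. norm (g x) \<le> b / (2 * T)"
        "\<And>x. x \<in> closure \<Omega> \<Longrightarrow> ?c \<le> l x"
      using \<delta>(2) by metis
    have Tg: "norm (T *\<^sub>R g x) \<le> b / 2" for x
      using mult_left_mono[OF \<psi>(2)[of x], of T] T by simp
    have "T * ?c - (b / 2)\<^sup>2 \<le> - s * \<sigma>"
    proof (rule eigenvalue_comparison[OF \<Omega>(1-4) u has_grad_lap_cmult[OF \<psi>(1), of T] s])
      fix x assume "x \<in> frontier \<Omega>"
      then have "b \<le> - s * \<beta> x" using \<beta> \<Omega>(5) by (auto simp: closure_Un_frontier)
      then show "norm (T *\<^sub>R g x) < - s * \<beta> x" using Tg[of x] b by linarith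
    next
      fix x assume "x \<in> \<Omega>"
      then show "T * ?c \<le> T * l x" using \<psi>(3)[of x] closure_subset T by (auto intro!: mult_left_mono)
    qed (rule Tg)
    moreover have "(b / 2)\<^sup>2 \<le> b\<^sup>2" using b by (intro power_mono) auto
    ultimately show "K < - s * \<sigma>" using Tc by linarith
  qed
qed

theorem theorem1p2:
  fixes D :: "(real^'n::finite) set" and \<beta> :: "real^'n \<Rightarrow> real"
  assumes "CARD('n) \<ge> 2" and "open D" and "continuous_on D \<beta>"
  shows "((INF x\<in>D. ereal (\<beta> x)) > 0 \<longrightarrow>
           (\<forall>K::real. \<exists>\<delta>>0. \<forall>\<Omega> \<sigma>. admissible_domain D \<Omega> \<and> is_principal_eigenvalue \<beta> \<Omega> \<sigma> \<and>
              measure lebesgue \<Omega> < \<delta> \<longrightarrow> \<sigma> > K)) \<and>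
         ((SUP x\<in>D. ereal (\<beta> x)) < 0 \<longrightarrow>
           (\<forall>K::real. \<exists>\<delta>>0. \<forall>\<Omega> \<sigma>. admissible_domain D \<Omega> \<and> is_principal_eigenvalue \<beta> \<Omega> \<sigma> \<and>
              measure lebesgue \<Omega> < \<delta> \<longrightarrow> \<sigma> < - K))"
proof (intro conjI impI allI)
  fix K :: real
  assume "(INF x\<in>D. ereal (\<beta> x)) > 0"
  then obtain b where b: "0 < ereal b" "ereal b < (INF x\<in>D. ereal (\<beta> x))"
    using ereal_dense2 by blast
  have "b \<le> - (-1) * \<beta> x" if "x \<in> D" for x
    using less_INF_D[OF b(2) that] by simp
  then show "\<exists>\<delta>>0. \<forall>\<Omega> \<sigma>. admissible_domain D \<Omega> \<and> is_principal_eigenvalue \<beta> \<Omega> \<sigma> \<and>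
              measure lebesgue \<Omega> < \<delta> \<longrightarrow> \<sigma> > K"
    using principal_eigenvalue_signed_bound[of "-1" b D \<beta> K] b(1) by simp
next
  fix K :: real
  assume "(SUP x\<in>D. ereal (\<beta> x)) < 0"
  then obtain b where b: "(SUP x\<in>D. ereal (\<beta> x)) < ereal b" "ereal b < 0"
    using ereal_dense2 by blast
  have "- b \<le> - 1 * \<beta> x" if "x \<in> D" for x
    using SUP_lessD[OF b(1) that] by simp
  then have "\<exists>\<delta>>0. \<forall>\<Omega> \<sigma>. admissible_domain D \<Omega> \<and> is_principal_eigenvalue \<beta> \<Omega> \<sigma> \<and>
              measure lebesgue \<Omega> < \<delta> \<longrightarrow> K < - 1 * \<sigma>"
    using b(2) by (intro principal_eigenvalue_signed_bound[of 1 "- b"]) auto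
  then show "\<exists>\<delta>>0. \<forall>\<Omega> \<sigma>. admissible_domain D \<Omega> \<and> is_principal_eigenvalue \<beta> \<Omega> \<sigma> \<and>
              measure lebesgue \<Omega> < \<delta> \<longrightarrow> \<sigma> < - K"
    by (simp add: less_minus_iff)
qed

end
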